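(* Let $\boldsymbol{\lambda}=\{\lambda_n\}_{n\in\mathbb{N}}$ be a sequence of complex numbers and let $h_{\overline{\boldsymbol{\lambda}}}(z)=\sum_{n=0}^\infty \overline{\lambda_n}z^n$. Then the Hankel type operator $\mathcal{H}_{\boldsymbol{\lambda}}$ is bounded on the Dirichlet space $\mathcal{D}$ if and only if $h_{\overline{\boldsymbol{\lambda}}}$ is analytic on $\mathbb{D}$ (i.e. the power series converges in $\mathbb{D}$) and the measure $|h_{\overline{\boldsymbol{\lambda}}}'(z)|^2dA(z)$ is a Carleson measure for the Dirichlet space $\mathcal{D}$.
   Context: $\mathbb{N}$ is the set of nonnegative integers, $\mathbb{D}$ is the open unit disk, $H(\mathbb{D})$ is the space of analytic functions on $\mathbb{D}$, and $dA=\pi^{-1}dx\,dy$ is normalized Lebesgue measure on $\mathbb{D}$. The Dirichlet space $\mathcal{D}$ is the Hilbert space of $f\in H(\mathbb{D})$ with $\|f\|_{\mathcal{D}}^2=|f(0)|^2+\int_{\mathbb{D}}|f'(z)|^2dA(z)<\infty$, with inner product $\langle f,g\rangle_{\mathcal{D}}=f(0)\overline{g(0)}+\int_{\mathbb{D}}f'(z)\overline{g'(z)}\,dA(z)$. For $f(z)=\sum_{k\ge0}a_kz^k\in H(\mathbb{D})$, the Hankel type operator is $\mathcal{H}_{\boldsymbol{\lambda}}(f)(z)=\sum_{n=0}^\infty\left(\sum_{k=0}^\infty\lambda_{n+k}a_k\right)z^n$, whenever the right-hand side makes sense and defines an analytic function in $\mathbb{D}$. It is bounded on $\mathcal{D}$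 if $\mathcal{H}_{\boldsymbol{\lambda}}(f)$ is well defined in $H(\mathbb{D})$ for every $f\in\mathcal{D}$ and there is a constant $C>0$ with $\|\mathcal{H}_{\boldsymbol{\lambda}}(f)\|_{\mathcal{D}}\le C\|f\|_{\mathcal{D}}$ for all $f\in\mathcal{D}$. A finite positive Borel measure $\nu$ on $\mathbb{D}$ is a Carleson measure for $\mathcal{D}$ if there is a constant $C>0$ such that $\left(\int_{\mathbb{D}}|f|^2d\nu\right)^{1/2}\le C\|f\|_{\mathcal{D}}$ for all $f\in\mathcal{D}$. *)

theory Defs
  imports "HOL-Complex_Analysis.Complex_Analysis"
begin

abbreviation unit_disk :: "complex set" where
  "unit_disk \<equiv> ball 0 1"

definition disk_area :: "complex measure" where
  "disk_area = density (restrict_space lborel unit_disk) (\<lambda>_. ennreal (1 / pi))"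

text \<open>Elements of \<open>H(\<D>)\<close> are represented by total functions on \<^typ>\<open>complex\<close>;
  every notion below depends only on the values on the open unit disk.\<close>

definition dirichlet_space :: "(complex \<Rightarrow> complex) set" where
  "dirichlet_space =
     {f. f holomorphic_on unit_disk \<and> integrable disk_area (\<lambda>z. (cmod (deriv f z))\<^sup>2)}"

definition dirichlet_norm :: "(complex \<Rightarrow> complex) \<Rightarrow> real" where
  "dirichlet_norm f =
     sqrt ((cmod (f 0))\<^sup>2 + (\<integral>z. (cmod (deriv f z))\<^sup>2 \<partial>disk_area))"

definition power_series_on_disk :: "(nat \<Rightarrow> complex) \<Rightarrow> bool" where
  "power_series_on_disk c \<longleftrightarrow> (\<forall>z\<in>unit_disk. summable (\<lambda>n. c n * z ^ n))"

definition power_series :: "(nat \<Rightarrow> complex) \<Rightarrow> complex \<Rightarrow> complex" where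
  "power_series c z = (\<Sum>n. c n * z ^ n)"

abbreviation taylor_coeff :: "(complex \<Rightarrow> complex) \<Rightarrow> nat \<Rightarrow> complex" where
  "taylor_coeff f k \<equiv> fps_nth (fps_expansion f 0) k"

definition hankel_coeff :: "(nat \<Rightarrow> complex) \<Rightarrow> (complex \<Rightarrow> complex) \<Rightarrow> nat \<Rightarrow> complex" where
  "hankel_coeff lam f n = (\<Sum>k. lam (n + k) * taylor_coeff f k)"

text \<open>All the inner series must converge (ordinary, possibly conditional convergence), and the
  resulting power series must converge on the disk; its sum is then automatically analytic.\<close>

definition hankel_well_defined :: "(nat \<Rightarrow> complex) \<Rightarrow> (complex \<Rightarrow> complex) \<Rightarrow> bool" where
  "hankel_well_defined lam f \<longleftrightarrow>
     (\<forall>n. summable (\<lambda>k. lam (n + k) * taylor_coeff f k)) \<and>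
     power_series_on_disk (hankel_coeff lam f)"

definition hankel_op :: "(nat \<Rightarrow> complex) \<Rightarrow> (complex \<Rightarrow> complex) \<Rightarrow> complex \<Rightarrow> complex" where
  "hankel_op lam f = power_series (hankel_coeff lam f)"

text \<open>Membership of the image in the Dirichlet space is required explicitly, because
  \<^const>\<open>dirichlet_norm\<close> is only meaningful there: the Bochner integral of a
  non-integrable function is \<open>0\<close>, not \<open>\<infinity>\<close>.  The integrability clause in
  \<open>dirichlet_carleson\<close> serves the same purpose.\<close>

definition hankel_bounded_on_dirichlet :: "(nat \<Rightarrow> complex) \<Rightarrow> bool" where
  "hankel_bounded_on_dirichlet lam \<longleftrightarrow>
     (\<forall>f\<in>dirichlet_space. hankel_well_defined lam f) \<and>
     (\<exists>C>0. \<forall>f\<in>dirichlet_space.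
        hankel_op lam f \<in> dirichlet_space \<and>
        dirichlet_norm (hankel_op lam f) \<le> C * dirichlet_norm f)"

definition dirichlet_carleson :: "complex measure \<Rightarrow> bool" where
  "dirichlet_carleson \<nu> \<longleftrightarrow>
     sets \<nu> = sets (restrict_space borel unit_disk) \<and> finite_measure \<nu> \<and>
     (\<exists>C>0. \<forall>f\<in>dirichlet_space.
        integrable \<nu> (\<lambda>z. (cmod (f z))\<^sup>2) \<and>
        sqrt (\<integral>z. (cmod (f z))\<^sup>2 \<partial>\<nu>) \<le> C * dirichlet_norm f)"

definition conj_symbol :: "(nat \<Rightarrow> complex) \<Rightarrow> complex \<Rightarrow> complex" where
  "conj_symbol lam = power_series (\<lambda>n. cnj (lam n))"

end

theory Submission
  imports Defs
begin

text \<open>Let \<open>b\<close> be the conjugate symbol and \<open>P\<close> the Bergman projection. Comparing coefficients, the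
  derivative of \<open>H f\<close> is, up to conjugation, \<open>P (cnj f * b')\<close>, so boundedness of \<open>H\<close> means
  \<open>\<parallel>P (cnj f * b')\<parallel> \<lesssim> \<parallel>f\<parallel>\<close>, whereas the Carleson condition means \<open>\<parallel>cnj f * b'\<parallel> \<lesssim> \<parallel>f\<parallel>\<close>.
  As \<open>P\<close> is a contraction, the second condition implies the first. Conversely, the defect
  \<open>(1 - P) (cnj f * b')\<close> is the big Hankel operator with symbol \<open>cnj f\<close> applied to \<open>b'\<close>; this operator is
  Hilbert--Schmidt on the Bergman space with norm controlled by the Dirichlet norm of \<open>f\<close>, and \<open>b'\<close>
  is in the Bergman space because \<open>H 1\<close> is in the Dirichlet space. It suffices to treat polynomials
  \<open>f\<close>, by Fatou's lemma and convergence of Taylor sections.\<close>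

text \<open>For f in the Dirichlet space, square integrability of \<open>cnj f * b'\<close> is not
  known beforehand, so the Bergman projection cannot be applied to it directly. For a polynomial f
  it can, and there P reduces to arithmetic with moments of the area measure: the estimates are made
  with explicit coefficients and no projection operator is ever formed. With \<mu>_n the conjugate
  of \<open>lam n\<close> and a_k the coefficients of f, the j-th coefficient of the projection is
  j+1 times the sum over k of \<open>cnj (a k) * \<mu> (Suc j + k)\<close>, which is the conjugate
  of the j-th coefficient of (H f)'. The Hilbert-Schmidt bound has two sources. For fixed n, the
  images of z^n under the big Hankel operators with symbols \<open>cnj z ^ k\<close> have angular
  frequency n - k, so they are orthogonal for distinct k and the coefficients a_k decouple. For
  fixed k, the squared norms of the images of the orthonormal basis sqrt(n+1) z^n sum to at most 2k,
  and k is the weight of |a_k|^2 in the Dirichlet norm.\<close>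

section \<open>Rotation invariance of planar Lebesgue measure\<close>

lemma measurable_case_prod_Complex:
  "(\<lambda>(x, y). Complex x y) \<in> borel_measurable (lborel \<Otimes>\<^sub>M lborel)"
proof -
  have "continuous_on UNIV (\<lambda>(x, y). Complex x y)"
    unfolding Complex_eq case_prod_beta by (intro continuous_intros)
  hence "(\<lambda>(x, y). Complex x y) \<in> borel_measurable borel"
    by (rule borel_measurable_continuous_onI)
  thus ?thesis by (simp add: lborel_prod)
qed

text \<open>Planar Lebesgue measure is determined by its values on boxes, and a box is a product of
  two intervals. The identification gives access to Fubini in the coordinates \<open>Re\<close> and
  \<open>Im\<close>.\<close>

lemma lborel_complex_eq: "(lborel :: complex measure) = distr (lborel \<Otimes>\<^sub>M lborel) borel (\<lambda>(x, y). Complex x y)"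
proof (rule lborel_eqI)
  note [measurable] = measurable_case_prod_Complex
  fix l u :: complex
  assume le: "\<And>b. b \<in> Basis \<Longrightarrow> l \<bullet> b \<le> u \<bullet> b"
  have "(\<lambda>(x, y). Complex x y) -` box l u = box (Re l) (Re u) \<times> box (Im l) (Im u)"
    by (auto simp: in_box_complex_iff)
  thus "emeasure (distr (lborel \<Otimes>\<^sub>M lborel) borel (\<lambda>(x, y). Complex x y)) (box l u) =
      (\<Prod>b\<in>Basis. (u - l) \<bullet> b)"
    using le[of 1] le[of \<i>]
    by (simp add: emeasure_distr space_pair_measure lborel.emeasure_pair_measure_Times Basis_complex_def ennreal_mult)
qed simp

text \<open>Both orders of integration are recorded because a horizontal shear is undone by
  integrating over x first and a vertical one by integrating over y first.\<close>

lemma nn_integral_lborel_complex: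
  assumes [measurable]: "f \<in> borel_measurable borel"
  shows "(\<integral>\<^sup>+z. f z \<partial>lborel) = (\<integral>\<^sup>+x. (\<integral>\<^sup>+y. f (Complex x y) \<partial>lborel) \<partial>lborel)"
    and "(\<integral>\<^sup>+z. f z \<partial>lborel) = (\<integral>\<^sup>+y. (\<integral>\<^sup>+x. f (Complex x y) \<partial>lborel) \<partial>lborel)"
proof -
  note C = measurable_case_prod_Complex
  have [measurable]: "(\<lambda>(x, y). f (Complex x y)) \<in> borel_measurable (lborel \<Otimes>\<^sub>M lborel)"
    using measurable_compose[OF C assms] by (simp add: case_prod_beta)
  have *: "(\<integral>\<^sup>+z. f z \<partial>lborel) = (\<integral>\<^sup>+p. (case p of (x, y) \<Rightarrow> f (Complex x y)) \<partial>(lborel \<Otimes>\<^sub>M lborel))"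
    by (subst lborel_complex_eq, subst nn_integral_distr[OF C]) (auto simp: case_prod_beta')
  show "(\<integral>\<^sup>+z. f z \<partial>lborel) = (\<integral>\<^sup>+x. (\<integral>\<^sup>+y. f (Complex x y) \<partial>lborel) \<partial>lborel)"
    unfolding * by (subst lborel.nn_integral_fst[symmetric]) auto
  show "(\<integral>\<^sup>+z. f z \<partial>lborel) = (\<integral>\<^sup>+y. (\<integral>\<^sup>+x. f (Complex x y) \<partial>lborel) \<partial>lborel)"
    unfolding * by (subst lborel_pair.nn_integral_snd[symmetric]) auto
qed

text \<open>On each line parallel to its direction a shear acts as a translation, under which
  one-dimensional Lebesgue measure is invariant.\<close>

lemma nn_integral_lborel_shear:
  fixes t :: real
  assumes [measurable]: "f \<in> borel_measurable borel"
  shows "(\<integral>\<^sup>+z. f (Complex (Re z + t * Im z) (Im z)) \<partial>lborel) = (\<integral>\<^sup>+z. f z \<partial>lborel)"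
    and "(\<integral>\<^sup>+z. f (Complex (Re z) (Im z + t * Re z)) \<partial>lborel) = (\<integral>\<^sup>+z. f z \<partial>lborel)"
proof -
  have m: "(\<lambda>z. Complex (Re z + t * Im z) (Im z)) \<in> borel_measurable borel"
     "(\<lambda>z. Complex (Re z) (Im z + t * Re z)) \<in> borel_measurable borel"
     "\<And>y. (\<lambda>x. Complex x y) \<in> borel_measurable borel" "\<And>x. (\<lambda>y. Complex x y) \<in> borel_measurable borel"
    unfolding Complex_eq by measurable
  note [measurable] = m m[THEN measurable_compose, OF assms]
  have "(\<integral>\<^sup>+x. f (Complex (x + t * y) y) \<partial>lborel) = (\<integral>\<^sup>+x. f (Complex x y) \<partial>lborel)" for y
    by (subst (2) nn_integral_real_affine[where c = 1 and t = "t * y"]) (auto simp: add.commute)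
  thus "(\<integral>\<^sup>+z. f (Complex (Re z + t * Im z) (Im z)) \<partial>lborel) = (\<integral>\<^sup>+z. f z \<partial>lborel)"
    by (simp add: nn_integral_lborel_complex(2))
  have "(\<integral>\<^sup>+y. f (Complex x (y + t * x)) \<partial>lborel) = (\<integral>\<^sup>+y. f (Complex x y) \<partial>lborel)" for x
    by (subst (2) nn_integral_real_affine[where c = 1 and t = "t * x"]) (auto simp: add.commute)
  thus "(\<integral>\<^sup>+z. f (Complex (Re z) (Im z + t * Re z)) \<partial>lborel) = (\<integral>\<^sup>+z. f z \<partial>lborel)"
    by (simp add: nn_integral_lborel_complex(1))
qed

text \<open>A rotation by an angle that is not a multiple of \<open>\<pi>\<close> is a product of three shears.\<close>
lemma distr_lborel_rotation:
  fixes w :: complex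
  assumes "cmod w = 1" "Im w \<noteq> 0"
  shows "distr lborel borel ((*) w) = lborel"
proof (rule measure_eqI)
  fix A assume "A \<in> sets (distr lborel borel ((*) w))"
  hence [measurable]: "A \<in> sets borel" by simp
  \<comment> \<open>For \<open>w = cis \<theta>\<close> this is -tan(\<theta>/2): horizontal shears
    by this amount stand on either side of a vertical shear by sin \<theta>.\<close>
  define t where "t = (Re w - 1) / Im w"
  define f :: "complex \<Rightarrow> ennreal" where "f = indicator A"
  define S where "S = (\<lambda>z. Complex (Re z + t * Im z) (Im z))"
  define T where "T = (\<lambda>z. Complex (Re z) (Im z + Im w * Re z))"
  have [measurable]: "f \<in> borel_measurable borel" by (simp add: f_def)
  have [measurable]: "S \<in> borel_measurable borel" "T \<in> borel_measurable borel"
    unfolding Complex_eq S_def T_def by measurable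
  have w2: "Re w * Re w + Im w * Im w = 1"
    using assms(1) by (metis cmod_power2 power2_eq_square one_power2)
  have t1: "t * Im w = Re w - 1" using assms(2) by (simp add: t_def)
  have "Im w * (t * (Re w + 1) + Im w) = 0" using t1 w2 by algebra
  hence "t * (Re w + 1) + Im w = 0" using assms(2) by simp
  \<comment> \<open>These two relations say that the first row of the matrix of the three shears is
    that of the rotation; the first relation also settles the second row.\<close>
  hence t: "t * Im w = Re w - 1" "t * (t * Im w) = - Im w - 2 * t"
    using t1 by (simp, algebra)
  have ST: "w * z = S (T (S z))" for z
    using t by (auto simp: complex_eq_iff S_def T_def) algebra+
  have intS: "(\<integral>\<^sup>+z. h (S z) \<partial>lborel) = (\<integral>\<^sup>+z. h z \<partial>lborel)"
    and intT: "(\<integral>\<^sup>+z. h (T z) \<partial>lborel) = (\<integral>\<^sup>+z. h z \<partial>lborel)"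
    if "h \<in> borel_measurable borel" for h :: "complex \<Rightarrow> ennreal"
    unfolding S_def T_def by (rule nn_integral_lborel_shear[OF that])+
  have "emeasure (distr lborel borel ((*) w)) A = (\<integral>\<^sup>+z. f (w * z) \<partial>lborel)"
    using nn_integral_distr[of "(*) w" lborel borel f] by (simp add: f_def)
  also have "\<dots> = (\<integral>\<^sup>+z. f (S (T (S z))) \<partial>lborel)" by (simp add: ST)
  also have "\<dots> = (\<integral>\<^sup>+z. f (S (T z)) \<partial>lborel)" by (rule intS[of "\<lambda>z. f (S (T z))"]) measurable
  also have "\<dots> = (\<integral>\<^sup>+z. f (S z) \<partial>lborel)" by (rule intT[of "\<lambda>z. f (S z)"]) measurable
  also have "\<dots> = (\<integral>\<^sup>+z. f z \<partial>lborel)" by (rule intS) measurable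
  also have "\<dots> = emeasure lborel A" by (simp add: f_def)
  finally show "emeasure (distr lborel borel ((*) w)) A = emeasure lborel A" .
qed simp

section \<open>Moments of the area measure\<close>

lemma space_disk_area [simp]: "space disk_area = unit_disk"
  by (simp add: disk_area_def space_restrict_space)

lemma sets_disk_area [simp, measurable_cong]: "sets disk_area = sets (restrict_space borel unit_disk)"
  by (simp add: disk_area_def cong: sets_restrict_space_cong)

lemma continuous_on_measurable_disk_area:
  "continuous_on unit_disk f \<Longrightarrow> f \<in> borel_measurable disk_area"
  by (subst measurable_cong_sets[OF sets_disk_area refl]) (rule borel_measurable_continuous_on_restrict)

lemma borel_measurable_disk_area: "f \<in> measurable borel N \<Longrightarrow> f \<in> measurable disk_area N"
  by (subst measurable_cong_sets[OF sets_disk_area refl]) (rule measurable_restrict_space1)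

lemma measurable_id_disk_area [measurable]: "(\<lambda>z. z) \<in> borel_measurable disk_area"
  by (intro borel_measurable_disk_area) simp

lemma emeasure_disk_area:
  "A \<in> sets borel \<Longrightarrow> A \<subseteq> unit_disk \<Longrightarrow> emeasure disk_area A = ennreal (1 / pi) * emeasure lborel A"
  unfolding disk_area_def
  by (subst emeasure_density_const) (auto simp: sets_restrict_space emeasure_restrict_space)

lemma emeasure_disk_area_cball:
  assumes "0 \<le> r" "r < 1"
  shows "emeasure disk_area (cball 0 r) = ennreal (r\<^sup>2)"
  using assms by (subst emeasure_disk_area) (auto simp: emeasure_cball unit_ball_vol_2 ennreal_mult[symmetric])

lemma emeasure_disk_area_disk: "emeasure disk_area unit_disk = 1"
  by (subst emeasure_disk_area) (auto simp: emeasure_ball unit_ball_vol_2 ennreal_mult[symmetric])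

interpretation disk_area: finite_measure disk_area
  by standard (simp add: emeasure_disk_area_disk)

lemma integral_disk_area:
  fixes f :: "complex \<Rightarrow> 'a :: {banach, second_countable_topology}"
  assumes [measurable]: "f \<in> borel_measurable borel"
  shows "(LINT z|disk_area. f z) = (1 / pi) *\<^sub>R (LINT z|lborel. indicator unit_disk z *\<^sub>R f z)"
proof -
  have "f \<in> borel_measurable (restrict_space lborel unit_disk)"
    by (intro measurable_restrict_space1) simp
  thus ?thesis unfolding disk_area_def
    by (subst integral_density) (auto simp: integral_restrict_space)
qed

text \<open>The disk of radius r has normalized area r^2, so |z|^2 is uniformly distributed on
  [0, 1]. Radial integrals thereby become integrals over an interval.\<close>

lemma disk_area_distr_cmod_sq:
  "distr disk_area borel (\<lambda>z. (cmod z)\<^sup>2) = density lborel (indicator {0..1})" (is "?M = ?N")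
proof (rule measure_eqI_lessThan)
  fix x :: real
  have vim: "(\<lambda>z::complex. (cmod z)\<^sup>2) -` {x<..} \<inter> unit_disk = {z\<in>unit_disk. x < (cmod z)\<^sup>2}" by auto
  have M: "emeasure ?M {x<..} = emeasure disk_area {z\<in>unit_disk. x < (cmod z)\<^sup>2}"
    by (subst emeasure_distr) (simp_all only: space_disk_area vim, auto)
  show "emeasure ?M {x<..} < \<infinity>"
    unfolding M infinity_ennreal_def less_top[symmetric] by (rule disk_area.emeasure_finite)
  have N: "emeasure ?N {x<..} = emeasure lborel ({0..1} \<inter> {x<..})"
  proof -
    have "emeasure ?N {x<..} = (\<integral>\<^sup>+s. indicator {0..1} s * indicator {x<..} s \<partial>lborel)"
      by (rule emeasure_density) simp_all
    also have "\<dots> = (\<integral>\<^sup>+s. indicator ({0..1} \<inter> {x<..}) s \<partial>lborel)"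
      by (intro nn_integral_cong) (simp add: indicator_def)
    also have "\<dots> = emeasure lborel ({0..1} \<inter> {x<..})"
      by (rule nn_integral_indicator) simp
    finally show ?thesis .
  qed
  consider "x < 0" | "0 \<le> x" "x < 1" | "1 \<le> x" by linarith
  thus "emeasure ?M {x<..} = emeasure ?N {x<..}"
  proof cases
    case 1
    have "x < (cmod z)\<^sup>2" for z using 1 by (rule less_le_trans) simp
    hence *: "{z\<in>unit_disk. x < (cmod z)\<^sup>2} = unit_disk" by blast
    have "{0..1} \<inter> {x<..} = {0..1}" using 1 by auto
    thus ?thesis unfolding M N * emeasure_disk_area_disk by simp
  next
    case 2
    have sq: "z \<in> cball 0 (sqrt x) \<longleftrightarrow> \<not> x < (cmod z)\<^sup>2" for z
      using real_sqrt_le_iff[of "(cmod z)\<^sup>2" x] by (simp add: not_less)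
    have x1: "sqrt x < 1" using 2 by simp
    have eq: "{z\<in>unit_disk. x < (cmod z)\<^sup>2} = unit_disk - cball 0 (sqrt x)"
      using sq by blast
    have sub: "cball 0 (sqrt x) \<subseteq> (unit_disk :: complex set)"
      using x1 by (intro subsetI) (simp only: mem_cball_0 mem_ball_0 le_less_trans)
    have "emeasure disk_area (unit_disk - cball 0 (sqrt x)) =
        emeasure disk_area unit_disk - emeasure disk_area (cball 0 (sqrt x))"
      using sub by (intro emeasure_Diff disk_area.emeasure_finite) (auto simp: sets_restrict_space)
    also have "\<dots> = 1 - ennreal x"
      unfolding emeasure_disk_area_disk using 2 x1 by (subst emeasure_disk_area_cball) auto
    also have "\<dots> = ennreal (1 - x)"
      using 2 ennreal_minus[of x 1] by simp
    moreover have "{0..1} \<inter> {x<..} = {x<..1}" using 2 by auto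
    ultimately show ?thesis unfolding M N eq using 2 by simp
  next
    case 3
    have "\<not> x < (cmod z)\<^sup>2" if "z \<in> unit_disk" for z
    proof -
      have "(cmod z)\<^sup>2 \<le> 1" using that by (simp add: power_le_one)
      thus ?thesis using 3 by linarith
    qed
    hence *: "{z\<in>unit_disk. x < (cmod z)\<^sup>2} = {}" by blast
    have "{0..1} \<inter> {x<..} = {}" using 3 by auto
    thus ?thesis unfolding M N * by simp
  qed
qed auto

text \<open>Substituting s = |z|^2 turns the integral into that of s^n over [0, r^2]. The radius is
  kept general because the lower half of Parseval's identity first works on a disk with r <
  1.\<close>

lemma disk_area_moment_diag:
  assumes "0 \<le> r" "r \<le> 1"
  shows "(LINT z|disk_area. indicator (cball 0 r) z * ((cmod z)\<^sup>2) ^ n) = r ^ (2 * n + 2) / (n + 1)"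
proof -
  have "(LINT z|disk_area. indicator (cball 0 r) z * ((cmod z)\<^sup>2) ^ n)
     = (LINT z|disk_area. (\<lambda>s. indicator {..r\<^sup>2} s * s ^ n) ((cmod z)\<^sup>2))"
    using assms by (intro Bochner_Integration.integral_cong) (auto simp: indicator_def abs_le_square_iff[symmetric])
  also have "\<dots> = (LINT s|density lborel (indicator {0..1}). indicator {..r\<^sup>2} s * s ^ n)"
    unfolding disk_area_distr_cmod_sq[symmetric] by (subst integral_distr) auto
  also have "\<dots> = (LINT s|density lborel (\<lambda>s. ennreal (indicator {0..1} s)). indicator {..r\<^sup>2} s * s ^ n)"
    by (simp add: ennreal_indicator)
  also have "\<dots> = (LINT s|lborel. indicator {0..1} s * (indicator {..r\<^sup>2} s * s ^ n))"
    by (subst integral_density) auto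
  also have "\<dots> = (LINT s|lborel. s ^ n * indicator {0..r\<^sup>2} s)"
  proof -
    have "r\<^sup>2 \<le> 1" using assms by (simp add: power_le_one)
    thus ?thesis by (intro Bochner_Integration.integral_cong) (auto simp: indicator_def)
  qed
  also have "\<dots> = (r\<^sup>2) ^ Suc n / Suc n"
    by (subst integral_power) auto
  finally show ?thesis by (simp add: power_mult algebra_simps power2_eq_square)
qed

text \<open>Off the diagonal, a rotation by \<open>w\<close> preserves the disks and the measure but
  multiplies the integrand by \<open>w ^ n * cnj w ^ m\<close>. A choice of \<open>w\<close> for
  which this factor is not 1 forces the integral to vanish.\<close>

lemma disk_area_moment:
  assumes "0 \<le> r" "r \<le> 1"
  shows "(LINT z|disk_area. indicator (cball 0 r) z *\<^sub>R (z ^ n * cnj z ^ m)) =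
     (if n = m then of_real (r ^ (2 * n + 2) / (n + 1)) else 0)"
proof (cases "n = m")
  case True
  have "(LINT z|disk_area. indicator (cball 0 r) z *\<^sub>R (z ^ n * cnj z ^ m)) =
      (LINT z|disk_area. complex_of_real (indicator (cball 0 r) z * ((cmod z)\<^sup>2) ^ n))"
    using True by (intro Bochner_Integration.integral_cong)
      (auto simp: indicator_def power_mult_distrib[symmetric] complex_norm_square[symmetric])
  also have "\<dots> = of_real (r ^ (2 * n + 2) / (n + 1))"
    unfolding disk_area_moment_diag[OF assms, symmetric] by (rule integral_complex_of_real)
  finally show ?thesis using True by simp
next
  case False
  define d where "d = (if n < m then m - n else n - m)"
  have d: "d > 0" using False by (auto simp: d_def)
  \<comment> \<open>This angle gives \<open>w ^ d = \<i>\<close>, so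
    \<open>w ^ n * cnj w ^ m\<close> is one of the two square roots of -1 and differs from 1. The
    angle lies strictly between 0 and pi, so \<open>Im w\<close> is nonzero as the rotation lemma
    requires.\<close>
  define w where "w = cis (pi / (2 * d))"
  have nw: "cmod w = 1" by (simp add: w_def)
  have ww: "w * cnj w = 1" using nw by (simp add: complex_norm_square[symmetric])
  have wd: "w ^ d = \<i>" using d
  proof -
    have "w ^ d = cis (real d * (pi / (2 * d)))" unfolding w_def by (rule Complex.DeMoivre)
    also have "real d * (pi / (2 * d)) = pi / 2" using d by simp
    finally show ?thesis by simp
  qed
  have imw: "Im w \<noteq> 0"
  proof -
    have "0 < pi / (2 * d)" "pi / (2 * d) < pi" using d by (auto simp: field_simps)
    hence "sin (pi / (2 * d)) > 0" by (rule sin_gt_zero)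
    thus ?thesis by (simp add: w_def)
  qed
  have ne: "w ^ n * cnj w ^ m \<noteq> 1"
  proof (cases "n < m")
    case True
    hence "m = n + d" by (simp add: d_def)
    hence "w ^ n * cnj w ^ m = (w * cnj w) ^ n * cnj (w ^ d)" by (simp add: power_add power_mult_distrib)
    thus ?thesis by (simp add: ww wd complex_eq_iff)
  next
    case False
    hence "n = m + d" by (simp add: d_def)
    hence "w ^ n * cnj w ^ m = (w * cnj w) ^ m * (w ^ d)" by (simp add: power_add power_mult_distrib)
    thus ?thesis by (simp add: ww wd complex_eq_iff)
  qed
  define g where "g = (\<lambda>z. indicator unit_disk z *\<^sub>R indicator (cball 0 r) z *\<^sub>R (z ^ n * cnj z ^ m))"
  have [measurable]: "(\<lambda>z::complex. z ^ n * cnj z ^ m) \<in> borel_measurable borel"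
    by (intro borel_measurable_continuous_onI continuous_intros)
  have [measurable]: "(\<lambda>z. indicator (cball 0 r) z *\<^sub>R (z ^ n * cnj z ^ m)) \<in> borel_measurable borel"
    by (intro borel_measurable_scaleR borel_measurable_indicator) auto
  have [measurable]: "g \<in> borel_measurable borel"
    unfolding g_def by (intro borel_measurable_scaleR[OF borel_measurable_indicator]) auto
  have "(LINT z|lborel. g z) = (LINT z|distr lborel borel ((*) w). g z)"
    by (simp add: distr_lborel_rotation nw imw)
  also have "\<dots> = (LINT z|lborel. g (w * z))"
    by (subst integral_distr) auto
  also have "\<dots> = (LINT z|lborel. (w ^ n * cnj w ^ m) * g z)"
    by (intro Bochner_Integration.integral_cong)
       (auto simp: g_def norm_mult nw indicator_def power_mult_distrib)
  also have "\<dots> = (w ^ n * cnj w ^ m) * (LINT z|lborel. g z)" by simp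
  finally have "(LINT z|lborel. g z) = 0" using ne by simp
  thus ?thesis using False by (subst integral_disk_area) (simp_all add: g_def)
qed

section \<open>Parseval's identity on the disk\<close>

text \<open>Pythagoras for finitely many orthogonal functions. Measure and family are arbitrary
  because it serves twice: for monomials cut off at radius r, and for the functions
  \<open>big_hankel n k\<close> with n fixed.\<close>

lemma integral_cmod_sq_sum_orthogonal:
  fixes \<phi> :: "'i \<Rightarrow> 'a \<Rightarrow> complex"
  assumes fin: "finite I"
    and int: "\<And>i j. i \<in> I \<Longrightarrow> j \<in> I \<Longrightarrow> integrable M (\<lambda>z. \<phi> i z * cnj (\<phi> j z))"
    and orth: "\<And>i j. i \<in> I \<Longrightarrow> j \<in> I \<Longrightarrow> i \<noteq> j \<Longrightarrow> (LINT z|M. \<phi> i z * cnj (\<phi> j z)) = 0"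
  shows "integrable M (\<lambda>z. (cmod (\<Sum>i\<in>I. c i * \<phi> i z))\<^sup>2)"
    and "(LINT z|M. (cmod (\<Sum>i\<in>I. c i * \<phi> i z))\<^sup>2) = (\<Sum>i\<in>I. (cmod (c i))\<^sup>2 * (LINT z|M. (cmod (\<phi> i z))\<^sup>2))"
proof -
  have eq: "complex_of_real ((cmod (\<Sum>i\<in>I. c i * \<phi> i z))\<^sup>2) =
      (\<Sum>i\<in>I. \<Sum>j\<in>I. c i * cnj (c j) * (\<phi> i z * cnj (\<phi> j z)))" for z
    by (subst complex_norm_square, simp add: sum_product algebra_simps)
  have int': "integrable M (\<lambda>z. complex_of_real ((cmod (\<Sum>i\<in>I. c i * \<phi> i z))\<^sup>2))"
    unfolding eq using int by (intro Bochner_Integration.integrable_sum integrable_mult_right) auto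
  show "integrable M (\<lambda>z. (cmod (\<Sum>i\<in>I. c i * \<phi> i z))\<^sup>2)"
    using integrable_Re[OF int'] by simp
  have diag: "(LINT z|M. \<phi> i z * cnj (\<phi> i z)) = of_real (LINT z|M. (cmod (\<phi> i z))\<^sup>2)" for i
    unfolding complex_norm_square[symmetric] by (rule integral_complex_of_real)
  have "complex_of_real (LINT z|M. (cmod (\<Sum>i\<in>I. c i * \<phi> i z))\<^sup>2) =
      (LINT z|M. (\<Sum>i\<in>I. \<Sum>j\<in>I. c i * cnj (c j) * (\<phi> i z * cnj (\<phi> j z))))"
    unfolding eq[symmetric] by (rule integral_complex_of_real[symmetric])
  also have "\<dots> = (\<Sum>i\<in>I. \<Sum>j\<in>I. c i * cnj (c j) * (LINT z|M. \<phi> i z * cnj (\<phi> j z)))"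
  proof (subst Bochner_Integration.integral_sum)
    show "integrable M (\<lambda>z. \<Sum>j\<in>I. c i * cnj (c j) * (\<phi> i z * cnj (\<phi> j z)))" if "i \<in> I" for i
      using int that by (intro Bochner_Integration.integrable_sum integrable_mult_right) auto
  qed (intro sum.cong refl, subst Bochner_Integration.integral_sum, auto intro: int)
  also have "\<dots> = (\<Sum>i\<in>I. c i * cnj (c i) * (LINT z|M. \<phi> i z * cnj (\<phi> i z)))"
  proof (intro sum.cong refl)
    fix i assume i: "i \<in> I"
    have "(\<Sum>j\<in>I. c i * cnj (c j) * (LINT z|M. \<phi> i z * cnj (\<phi> j z))) =
      (\<Sum>j\<in>{i}. c i * cnj (c j) * (LINT z|M. \<phi> i z * cnj (\<phi> j z)))"
      using fin i orth by (intro sum.mono_neutral_right) auto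
    thus "(\<Sum>j\<in>I. c i * cnj (c j) * (LINT z|M. \<phi> i z * cnj (\<phi> j z))) =
      c i * cnj (c i) * (LINT z|M. \<phi> i z * cnj (\<phi> i z))" by simp
  qed
  also have "\<dots> = of_real (\<Sum>i\<in>I. (cmod (c i))\<^sup>2 * (LINT z|M. (cmod (\<phi> i z))\<^sup>2))"
    by (simp add: diag complex_norm_square del: of_real_power)
  finally show "(LINT z|M. (cmod (\<Sum>i\<in>I. c i * \<phi> i z))\<^sup>2) = (\<Sum>i\<in>I. (cmod (c i))\<^sup>2 * (LINT z|M. (cmod (\<phi> i z))\<^sup>2))"
    by (simp only: of_real_eq_iff)
qed

lemma integrable_disk_area_bounded:
  fixes f :: "complex \<Rightarrow> 'b :: {banach, second_countable_topology}"
  assumes "f \<in> borel_measurable disk_area" "\<And>z. cmod z < 1 \<Longrightarrow> norm (f z) \<le> B"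
  shows "integrable disk_area f"
  using assms by (intro disk_area.integrable_const_bound[where B = B]) auto

lemma integral_cmod_sq_polynomial:
  fixes c :: "nat \<Rightarrow> complex"
  assumes r: "0 \<le> r" "r \<le> 1" and fin: "finite I"
  shows "integrable disk_area (\<lambda>z. indicator (cball 0 r) z * (cmod (\<Sum>n\<in>I. c n * z ^ n))\<^sup>2)"
    and "(LINT z|disk_area. indicator (cball 0 r) z * (cmod (\<Sum>n\<in>I. c n * z ^ n))\<^sup>2) =
      (\<Sum>n\<in>I. (cmod (c n))\<^sup>2 * (r ^ (2 * n + 2) / (n + 1)))"
proof -
  \<comment> \<open>An indicator equals its own square, so the cut-off can be built into the
    orthogonal family.\<close>
  define \<phi> where "\<phi> = (\<lambda>n z. indicator (cball 0 r) z *\<^sub>R z ^ n :: complex)"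
  have prod: "\<phi> n z * cnj (\<phi> m z) = indicator (cball 0 r) z *\<^sub>R (z ^ n * cnj z ^ m)" for n m z
    by (simp add: \<phi>_def indicator_def)
  have meas: "(\<lambda>z::complex. z ^ n * cnj z ^ m) \<in> borel_measurable borel" for n m
    by (intro borel_measurable_continuous_onI continuous_intros)
  have int: "integrable disk_area (\<lambda>z. \<phi> n z * cnj (\<phi> m z))" for n m
    unfolding prod using meas[of n m]
    by (intro integrable_disk_area_bounded[where B = 1] borel_measurable_disk_area)
       (auto simp: norm_mult norm_power indicator_def intro!: mult_le_one power_le_one)
  have orth: "(LINT z|disk_area. \<phi> n z * cnj (\<phi> m z)) = (if n = m then of_real (r ^ (2 * n + 2) / (n + 1)) else 0)" for n m
    unfolding prod by (rule disk_area_moment[OF r])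
  have diag: "(LINT z|disk_area. (cmod (\<phi> n z))\<^sup>2) = r ^ (2 * n + 2) / (n + 1)" for n
  proof -
    have "complex_of_real (LINT z|disk_area. (cmod (\<phi> n z))\<^sup>2) = (LINT z|disk_area. \<phi> n z * cnj (\<phi> n z))"
      unfolding complex_norm_square[symmetric] by (rule integral_complex_of_real[symmetric])
    also have "\<dots> = of_real (r ^ (2 * n + 2) / (n + 1))" by (simp only: orth) simp
    finally show ?thesis by (simp only: of_real_eq_iff)
  qed
  have eq: "(cmod (\<Sum>n\<in>I. c n * \<phi> n z))\<^sup>2 = indicator (cball 0 r) z * (cmod (\<Sum>n\<in>I. c n * z ^ n))\<^sup>2" for z
    by (auto simp: \<phi>_def indicator_def)
  have orth0: "(LINT z|disk_area. \<phi> n z * cnj (\<phi> m z)) = 0" if "n \<noteq> m" for n m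
    using that by (simp only: orth if_False)
  note * = integral_cmod_sq_sum_orthogonal[where c = c and \<phi> = \<phi> and M = disk_area, OF fin int orth0]
  show "integrable disk_area (\<lambda>z. indicator (cball 0 r) z * (cmod (\<Sum>n\<in>I. c n * z ^ n))\<^sup>2)"
    using *(1) unfolding eq by auto
  show "(LINT z|disk_area. indicator (cball 0 r) z * (cmod (\<Sum>n\<in>I. c n * z ^ n))\<^sup>2) =
      (\<Sum>n\<in>I. (cmod (c n))\<^sup>2 * (r ^ (2 * n + 2) / (n + 1)))"
    using *(2) unfolding eq diag by auto
qed

lemma nn_integral_cmod_sq_polynomial:
  fixes c :: "nat \<Rightarrow> complex"
  assumes "finite I"
  shows "(\<integral>\<^sup>+z. ennreal ((cmod (\<Sum>n\<in>I. c n * z ^ n))\<^sup>2) \<partial>disk_area) = ennreal (\<Sum>n\<in>I. (cmod (c n))\<^sup>2 / (n + 1))"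
proof -
  have "(\<integral>\<^sup>+z. ennreal ((cmod (\<Sum>n\<in>I. c n * z ^ n))\<^sup>2) \<partial>disk_area) =
    (\<integral>\<^sup>+z. ennreal (indicator (cball 0 1) z * (cmod (\<Sum>n\<in>I. c n * z ^ n))\<^sup>2) \<partial>disk_area)"
    by (intro nn_integral_cong) (auto simp: indicator_def)
  also have "\<dots> = ennreal (\<Sum>n\<in>I. (cmod (c n))\<^sup>2 * (1 ^ (2 * n + 2) / (n + 1)))"
    using integral_cmod_sq_polynomial[OF _ _ assms, of 1 c]
    by (subst nn_integral_eq_integral) auto
  finally show ?thesis by simp
qed

section \<open>Power series and Taylor coefficients on the disk\<close>

lemma power_series_on_disk_norm:
  assumes "power_series_on_disk c" "cmod z < 1"
  shows "summable (\<lambda>n. norm (c n * z ^ n))"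
proof -
  obtain x where x: "cmod z < x" "x < 1" using dense[OF assms(2)] by blast
  have "summable (\<lambda>n. c n * of_real x ^ n)"
  proof -
    have "0 \<le> x" using x norm_ge_zero[of z] by linarith
    hence "complex_of_real x \<in> unit_disk" using x by simp
    thus ?thesis using assms(1) by (simp add: power_series_on_disk_def)
  qed
  thus ?thesis by (rule powser_insidea) (use x in auto)
qed

lemma power_series_sums:
  "power_series_on_disk c \<Longrightarrow> cmod z < 1 \<Longrightarrow> (\<lambda>n. c n * z ^ n) sums power_series c z"
  by (auto simp: power_series_on_disk_def power_series_def summable_sums)

lemma power_series_on_disk_diffs:
  "power_series_on_disk c \<Longrightarrow> power_series_on_disk (diffs c)"
  unfolding power_series_on_disk_def by (auto intro!: termdiff_converges[where K = 1])

lemma power_series_has_field_derivative: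
  "power_series_on_disk c \<Longrightarrow> cmod z < 1 \<Longrightarrow> (power_series c has_field_derivative power_series (diffs c) z) (at z)"
  unfolding power_series_def[abs_def] power_series_on_disk_def
  by (rule termdiffs_strong'[where K = 1]) auto

lemma power_series_holomorphic:
  "power_series_on_disk c \<Longrightarrow> power_series c holomorphic_on unit_disk"
  using power_series_has_field_derivative[of c] by (subst holomorphic_on_open) (simp, metis mem_ball_0)

lemma taylor_coeff_power_series:
  assumes "power_series_on_disk c"
  shows "taylor_coeff (power_series c) n = c n"
proof -
  \<comment> \<open>The point 1/2 is an arbitrary nonzero point of the disk; convergence there makes
    the radius of convergence positive.\<close>
  have "fps_conv_radius (Abs_fps c) \<ge> norm (1/2 :: complex)"
    unfolding fps_conv_radius_def
    by (rule conv_radius_geI) (use assms in \<open>auto simp: power_series_on_disk_def\<close>)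
  moreover have "ereal (norm (1/2 :: complex)) > 0" by simp
  ultimately have "fps_conv_radius (Abs_fps c) > 0" by (rule less_le_trans[rotated])
  hence "power_series c has_fps_expansion Abs_fps c"
    by (auto simp: has_fps_expansion_def power_series_def eval_fps_def)
  hence "fps_expansion (power_series c) 0 = Abs_fps c" by (rule fps_expansion_eqI)
  thus ?thesis by simp
qed

lemma holomorphic_taylor_sums:
  assumes "f holomorphic_on unit_disk" "cmod z < 1"
  shows "(\<lambda>n. taylor_coeff f n * z ^ n) sums f z"
  using holomorphic_power_series[OF assms(1), of z] assms(2) by (simp add: fps_expansion_def)

lemma holomorphic_taylor:
  assumes "f holomorphic_on unit_disk"
  shows "power_series_on_disk (taylor_coeff f)" and "cmod z < 1 \<Longrightarrow> power_series (taylor_coeff f) z = f z"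
  using holomorphic_taylor_sums[OF assms] by (auto simp: power_series_on_disk_def power_series_def sums_iff)

lemma deriv_power_series_taylor:
  assumes "f holomorphic_on unit_disk" "cmod z < 1"
  shows "deriv f z = power_series (diffs (taylor_coeff f)) z"
proof -
  have "(f has_field_derivative power_series (diffs (taylor_coeff f)) z) (at z)"
    using power_series_has_field_derivative[OF holomorphic_taylor(1)[OF assms(1)] assms(2)]
    by (rule has_field_derivative_transform_within_open[where S = unit_disk])
       (use assms holomorphic_taylor(2) in auto)
  thus ?thesis by (rule DERIV_imp_deriv)
qed

lemma measurable_power_series:
  "power_series_on_disk c \<Longrightarrow> power_series c \<in> borel_measurable disk_area"
  by (intro continuous_on_measurable_disk_area holomorphic_on_imp_continuous_on power_series_holomorphic)

text \<open>Both sides live in [0, \<infinity>], so the identity also decides square integrability.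
  Fatou along the partial sums gives the upper bound. For the lower bound, dominated convergence
  works on each smaller disk of radius r, and r tends to 1 only after the sum has been cut down to
  finitely many terms.\<close>

lemma nn_integral_cmod_sq_power_series:
  assumes c: "power_series_on_disk c"
  shows "(\<integral>\<^sup>+z. ennreal ((cmod (power_series c z))\<^sup>2) \<partial>disk_area) = (\<Sum>n. ennreal ((cmod (c n))\<^sup>2 / (n + 1)))"
proof (rule antisym)
  note [measurable] = measurable_power_series[OF c]
  have [measurable]: "(\<lambda>z. indicator (cball 0 r) z :: real) \<in> borel_measurable disk_area" for r
    by (intro borel_measurable_disk_area borel_measurable_indicator) auto
  define S where "S = (\<lambda>N z. \<Sum>n<N. c n * z ^ n)"
  have S: "(\<lambda>N. S N z) \<longlonglongrightarrow> power_series c z" if "cmod z < 1" for z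
    using power_series_sums[OF c that] by (simp add: sums_def S_def)
  have [measurable]: "S N \<in> borel_measurable disk_area" for N
    unfolding S_def by (intro continuous_on_measurable_disk_area continuous_intros)
  have "(\<integral>\<^sup>+z. ennreal ((cmod (power_series c z))\<^sup>2) \<partial>disk_area) =
      (\<integral>\<^sup>+z. liminf (\<lambda>N. ennreal ((cmod (S N z))\<^sup>2)) \<partial>disk_area)"
  proof (intro nn_integral_cong)
    fix z assume "z \<in> space disk_area"
    hence "(\<lambda>N. ennreal ((cmod (S N z))\<^sup>2)) \<longlonglongrightarrow> ennreal ((cmod (power_series c z))\<^sup>2)"
      by (intro tendsto_intros S) auto
    from lim_imp_Liminf[OF _ this] show "ennreal ((cmod (power_series c z))\<^sup>2) = liminf (\<lambda>N. ennreal ((cmod (S N z))\<^sup>2))"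
      by simp
  qed
  also have "\<dots> \<le> liminf (\<lambda>N. \<integral>\<^sup>+z. ennreal ((cmod (S N z))\<^sup>2) \<partial>disk_area)"
    by (intro nn_integral_liminf) measurable
  also have "\<dots> = liminf (\<lambda>N. \<Sum>n<N. ennreal ((cmod (c n))\<^sup>2 / (n + 1)))"
    unfolding S_def by (simp add: nn_integral_cmod_sq_polynomial)
  also have "\<dots> = (\<Sum>n. ennreal ((cmod (c n))\<^sup>2 / (n + 1)))"
    by (intro lim_imp_Liminf summable_LIMSEQ) auto
  finally show "(\<integral>\<^sup>+z. ennreal ((cmod (power_series c z))\<^sup>2) \<partial>disk_area) \<le> (\<Sum>n. ennreal ((cmod (c n))\<^sup>2 / (n + 1)))" .

  let ?X = "\<integral>\<^sup>+z. ennreal ((cmod (power_series c z))\<^sup>2) \<partial>disk_area"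
  have le: "ennreal (\<Sum>n<N. (cmod (c n))\<^sup>2 * (r ^ (2 * n + 2) / real (n + 1))) \<le> ?X" if r: "0 \<le> r" "r < 1" for N r
  proof -
    \<comment> \<open>Absolute convergence at radius r bounds all partial sums on the closed disk by
      one constant, the majorant for dominated convergence.\<close>
    define K where "K = (\<Sum>n. norm (c n * of_real r ^ n))"
    have sK: "summable (\<lambda>n. norm (c n * of_real r ^ n))"
      using power_series_on_disk_norm[OF c, of "of_real r"] r by simp
    have SK: "cmod (S M z) \<le> K" if "cmod z \<le> r" for M z
    proof -
      have "cmod (S M z) \<le> (\<Sum>n<M. norm (c n * of_real r ^ n))"
        unfolding S_def by (rule sum_norm_le) (use r that in \<open>auto simp: norm_mult norm_power intro!: mult_left_mono power_mono\<close>)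
      also have "\<dots> \<le> K" unfolding K_def by (intro sum_le_suminf sK) auto
      finally show ?thesis .
    qed
    have K0: "K \<ge> 0" using SK[of 0] r by (metis norm_ge_zero norm_zero order_trans)
    have lim: "(\<lambda>M. LINT z|disk_area. indicator (cball 0 r) z * (cmod (S M z))\<^sup>2) \<longlonglongrightarrow>
      (LINT z|disk_area. indicator (cball 0 r) z * (cmod (power_series c z))\<^sup>2)"
    proof (rule integral_dominated_convergence[where w = "\<lambda>_. K\<^sup>2"])
      show "AE z in disk_area. (\<lambda>M. indicat_real (cball 0 r) z * (cmod (S M z))\<^sup>2) \<longlonglongrightarrow>
         indicat_real (cball 0 r) z * (cmod (power_series c z))\<^sup>2"
        by (intro AE_I2 tendsto_intros S) auto
      show "AE z in disk_area. norm (indicat_real (cball 0 r) z * (cmod (S M z))\<^sup>2) \<le> K\<^sup>2" for M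
        using SK K0 by (intro AE_I2) (auto simp: indicator_def intro: power_mono)
    qed auto
    \<comment> \<open>By Parseval for polynomials, the terms from N on only add nonnegative
      summands.\<close>
    have "(\<Sum>n<N. (cmod (c n))\<^sup>2 * (r ^ (2 * n + 2) / real (n + 1))) \<le>
      (LINT z|disk_area. indicator (cball 0 r) z * (cmod (S M z))\<^sup>2)" if "M \<ge> N" for M
      unfolding S_def using r that
      by (subst integral_cmod_sq_polynomial(2)) (auto intro!: sum_mono2)
    hence "(\<Sum>n<N. (cmod (c n))\<^sup>2 * (r ^ (2 * n + 2) / real (n + 1))) \<le>
      (LINT z|disk_area. indicator (cball 0 r) z * (cmod (power_series c z))\<^sup>2)"
      by (intro tendsto_lowerbound[OF lim] eventually_sequentiallyI[of N]) auto
    also have "ennreal \<dots> = (\<integral>\<^sup>+z. ennreal (indicator (cball 0 r) z * (cmod (power_series c z))\<^sup>2) \<partial>disk_area)"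
    proof (rule nn_integral_eq_integral[symmetric])
      have "cmod (power_series c z) \<le> K" if "cmod z \<le> r" for z
        using SK that r by (intro tendsto_upperbound[OF tendsto_norm[OF S]]) auto
      thus "integrable disk_area (\<lambda>z. indicat_real (cball 0 r) z * (cmod (power_series c z))\<^sup>2)"
        using K0 by (intro integrable_disk_area_bounded[where B = "K\<^sup>2"]) (auto simp: indicator_def intro: power_mono)
    qed auto
    also have "\<dots> \<le> ?X" by (intro nn_integral_mono) (auto simp: indicator_def)
    finally show ?thesis by (simp add: ennreal_leI add.commute)
  qed
  have "(\<Sum>n<N. ennreal ((cmod (c n))\<^sup>2 / (n + 1))) \<le> ?X" for N
  proof -
    have "((\<lambda>r. ennreal (\<Sum>n<N. (cmod (c n))\<^sup>2 * (r ^ (2 * n + 2) / real (n + 1)))) \<longlongrightarrow>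
       ennreal (\<Sum>n<N. (cmod (c n))\<^sup>2 * (1 ^ (2 * n + 2) / (n + 1)))) (at_left 1)"
      by (intro tendsto_intros) auto
    moreover have "\<forall>\<^sub>F r in at_left 1. ennreal (\<Sum>n<N. (cmod (c n))\<^sup>2 * (r ^ (2 * n + 2) / real (n + 1))) \<le> ?X"
      by (rule eventually_mono[OF eventually_at_left_real[OF zero_less_one]]) (rule le; simp)
    ultimately have "ennreal (\<Sum>n<N. (cmod (c n))\<^sup>2 * (1 ^ (2 * n + 2) / (n + 1))) \<le> ?X"
      by (rule tendsto_upperbound) auto
    thus ?thesis by simp
  qed
  thus "(\<Sum>n. ennreal ((cmod (c n))\<^sup>2 / (n + 1))) \<le> ?X"
    by (intro suminf_le_const) auto
qed

section \<open>The Dirichlet space in terms of Taylor coefficients\<close>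

lemma nn_integral_norm_sq_finiteD:
  fixes f :: "'a \<Rightarrow> 'b :: {banach, second_countable_topology}"
  assumes "f \<in> borel_measurable M" "(\<integral>\<^sup>+z. ennreal ((norm (f z))\<^sup>2) \<partial>M) \<le> ennreal B" "B \<ge> 0"
  shows "integrable M (\<lambda>z. (norm (f z))\<^sup>2)" "(LINT z|M. (norm (f z))\<^sup>2) \<le> B"
proof -
  note [measurable] = assms(1)
  show i: "integrable M (\<lambda>z. (norm (f z))\<^sup>2)"
    using assms(2) by (intro integrableI_nonneg) (auto simp: top_unique less_top[symmetric])
  have "ennreal (LINT z|M. (norm (f z))\<^sup>2) \<le> ennreal B"
    using assms(2) by (subst (asm) nn_integral_eq_integral[OF i]) auto
  thus "(LINT z|M. (norm (f z))\<^sup>2) \<le> B" using assms(3) by (simp add: ennreal_le_iff)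
qed

lemma power_series_integral:
  assumes c: "power_series_on_disk c" and s: "summable (\<lambda>n. (cmod (c n))\<^sup>2 / (n + 1))"
  shows "integrable disk_area (\<lambda>z. (cmod (power_series c z))\<^sup>2)"
    and "(LINT z|disk_area. (cmod (power_series c z))\<^sup>2) = (\<Sum>n. (cmod (c n))\<^sup>2 / (n + 1))"
proof -
  note [measurable] = measurable_power_series[OF c]
  have eq: "(\<integral>\<^sup>+z. ennreal ((cmod (power_series c z))\<^sup>2) \<partial>disk_area) = ennreal (\<Sum>n. (cmod (c n))\<^sup>2 / (n + 1))"
    unfolding nn_integral_cmod_sq_power_series[OF c] using s by (intro suminf_ennreal2) auto
  have nn: "(\<Sum>n. (cmod (c n))\<^sup>2 / (n + 1)) \<ge> 0" using s by (intro suminf_nonneg) auto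
  show i: "integrable disk_area (\<lambda>z. (cmod (power_series c z))\<^sup>2)"
    using eq nn by (intro nn_integral_norm_sq_finiteD(1)[where B = "(\<Sum>n. (cmod (c n))\<^sup>2 / (n + 1))"]) auto
  show "(LINT z|disk_area. (cmod (power_series c z))\<^sup>2) = (\<Sum>n. (cmod (c n))\<^sup>2 / (n + 1))"
    using eq nn by (subst (asm) nn_integral_eq_integral[OF i]) auto
qed

lemma cmod_diffs_sq: "(cmod (diffs c n))\<^sup>2 / real (n + 1) = real (n + 1) * (cmod (c (Suc n)))\<^sup>2"
proof -
  have "cmod (diffs c n) = real (n + 1) * cmod (c (Suc n))"
    unfolding diffs_def norm_mult norm_of_nat by simp
  thus ?thesis by (simp add: power_mult_distrib power2_eq_square del: of_nat_Suc of_nat_add)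
qed

text \<open>This is the Dirichlet integral in coefficients: the derivative has coefficients (n+1)
  c_(n+1), and Parseval's identity divides the square of each by n+1.\<close>

definition dirichlet_sum :: "(nat \<Rightarrow> complex) \<Rightarrow> real" where
  "dirichlet_sum c = (\<Sum>n. (n + 1) * (cmod (c (Suc n)))\<^sup>2)"

abbreviation dirichlet_summable :: "(nat \<Rightarrow> complex) \<Rightarrow> bool" where
  "dirichlet_summable c \<equiv> summable (\<lambda>n. (n + 1) * (cmod (c (Suc n)))\<^sup>2)"

lemma dirichlet_sum_nonneg: "dirichlet_summable c \<Longrightarrow> dirichlet_sum c \<ge> 0"
  unfolding dirichlet_sum_def by (intro suminf_nonneg) auto

lemma nn_integral_deriv_sq:
  assumes "f holomorphic_on unit_disk"
  shows "(\<integral>\<^sup>+z. ennreal ((cmod (deriv f z))\<^sup>2) \<partial>disk_area) =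
    (\<Sum>n. ennreal ((n + 1) * (cmod (taylor_coeff f (Suc n)))\<^sup>2))"
proof -
  have "(\<integral>\<^sup>+z. ennreal ((cmod (deriv f z))\<^sup>2) \<partial>disk_area) =
     (\<integral>\<^sup>+z. ennreal ((cmod (power_series (diffs (taylor_coeff f)) z))\<^sup>2) \<partial>disk_area)"
    using deriv_power_series_taylor[OF assms] by (intro nn_integral_cong) auto
  also have "\<dots> = (\<Sum>n. ennreal ((cmod (diffs (taylor_coeff f) n))\<^sup>2 / (n + 1)))"
    by (intro nn_integral_cmod_sq_power_series power_series_on_disk_diffs holomorphic_taylor(1) assms)
  finally show ?thesis unfolding cmod_diffs_sq .
qed

lemma measurable_deriv_disk_area:
  "f holomorphic_on unit_disk \<Longrightarrow> deriv f \<in> borel_measurable disk_area"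
  by (intro continuous_on_measurable_disk_area holomorphic_on_imp_continuous_on holomorphic_deriv) auto

lemma dirichlet_space_iff:
  "f \<in> dirichlet_space \<longleftrightarrow> f holomorphic_on unit_disk \<and> dirichlet_summable (taylor_coeff f)"
proof (cases "f holomorphic_on unit_disk")
  case True
  note [measurable] = measurable_deriv_disk_area[OF True]
  have "integrable disk_area (\<lambda>z. (cmod (deriv f z))\<^sup>2) \<longleftrightarrow> (\<integral>\<^sup>+z. ennreal ((cmod (deriv f z))\<^sup>2) \<partial>disk_area) < \<infinity>"
    by (subst integrable_iff_bounded) auto
  also have "\<dots> \<longleftrightarrow> dirichlet_summable (taylor_coeff f)"
    unfolding nn_integral_deriv_sq[OF True] infinity_ennreal_def less_top[symmetric]
    by (auto intro!: summable_suminf_not_top simp: suminf_ennreal2)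
  finally show ?thesis using True by (simp add: dirichlet_space_def)
qed (simp add: dirichlet_space_def)

lemma dirichlet_norm_sq:
  assumes "f \<in> dirichlet_space"
  shows "(dirichlet_norm f)\<^sup>2 = (cmod (taylor_coeff f 0))\<^sup>2 + dirichlet_sum (taylor_coeff f)"
proof -
  have h: "f holomorphic_on unit_disk" and s: "dirichlet_summable (taylor_coeff f)"
    and i: "integrable disk_area (\<lambda>z. (cmod (deriv f z))\<^sup>2)"
    using assms dirichlet_space_iff[of f] by (auto simp: dirichlet_space_def)
  have "ennreal (LINT z|disk_area. (cmod (deriv f z))\<^sup>2) = ennreal (dirichlet_sum (taylor_coeff f))"
    using nn_integral_deriv_sq[OF h] s i unfolding dirichlet_sum_def
    by (subst (asm) nn_integral_eq_integral) (auto simp: suminf_ennreal2)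
  hence "(LINT z|disk_area. (cmod (deriv f z))\<^sup>2) = dirichlet_sum (taylor_coeff f)"
    using dirichlet_sum_nonneg[OF s] by (subst (asm) ennreal_inj) auto
  thus ?thesis using dirichlet_sum_nonneg[OF s]
    by (simp add: dirichlet_norm_def fps_expansion_def)
qed

lemma dirichlet_norm_nonneg [simp]: "dirichlet_norm f \<ge> 0"
  by (simp add: dirichlet_norm_def)

lemma power_series_in_dirichlet:
  assumes "power_series_on_disk c" "dirichlet_summable c"
  shows "power_series c \<in> dirichlet_space"
    and "(dirichlet_norm (power_series c))\<^sup>2 = (cmod (c 0))\<^sup>2 + dirichlet_sum c"
proof -
  show *: "power_series c \<in> dirichlet_space"
    using assms by (simp add: dirichlet_space_iff power_series_holomorphic taylor_coeff_power_series)
  show "(dirichlet_norm (power_series c))\<^sup>2 = (cmod (c 0))\<^sup>2 + dirichlet_sum c"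
    using dirichlet_norm_sq[OF *] by (simp add: dirichlet_sum_def taylor_coeff_power_series[OF assms(1)])
qed

text \<open>Polynomials are encoded as power series with a cut-off coefficient sequence, so that the
  results on power series apply to them unchanged.\<close>

definition truncate_coeffs :: "nat \<Rightarrow> (nat \<Rightarrow> complex) \<Rightarrow> nat \<Rightarrow> complex" where
  "truncate_coeffs d a k = (if k < d then a k else 0)"

lemma power_series_truncate:
  "power_series_on_disk (truncate_coeffs d a)"
  "power_series (truncate_coeffs d a) z = (\<Sum>k<d. a k * z ^ k)"
proof -
  have "(\<lambda>k. truncate_coeffs d a k * z ^ k) sums (\<Sum>k<d. truncate_coeffs d a k * z ^ k)" for z
    by (rule sums_finite) (auto simp: truncate_coeffs_def)
  hence *: "(\<lambda>k. truncate_coeffs d a k * z ^ k) sums (\<Sum>k<d. a k * z ^ k)" for z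
    by (simp add: truncate_coeffs_def)
  show "power_series_on_disk (truncate_coeffs d a)"
    "power_series (truncate_coeffs d a) z = (\<Sum>k<d. a k * z ^ k)"
    using * by (auto simp: power_series_on_disk_def power_series_def sums_iff)
qed

lemma dirichlet_summable_truncate: "dirichlet_summable (truncate_coeffs d a)"
  by (rule summable_finite[of "{..<d}"]) (auto simp: truncate_coeffs_def)

lemma truncate_in_dirichlet: "power_series (truncate_coeffs d a) \<in> dirichlet_space"
  by (intro power_series_in_dirichlet power_series_truncate dirichlet_summable_truncate)

text \<open>Cutting off only drops nonnegative terms from the squared norm. The bound does not
  depend on \<open>d\<close>, which lets estimates for Taylor sections pass to \<open>f\<close> with
  the same constant.\<close>

lemma dirichlet_norm_truncate_le:
  assumes "f \<in> dirichlet_space"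
  shows "dirichlet_norm (power_series (truncate_coeffs d (taylor_coeff f))) \<le> dirichlet_norm f"
proof (rule power2_le_imp_le)
  have "dirichlet_sum (truncate_coeffs d (taylor_coeff f)) \<le> dirichlet_sum (taylor_coeff f)"
    unfolding dirichlet_sum_def
    using assms dirichlet_summable_truncate
    by (intro suminf_le) (auto simp: dirichlet_space_iff truncate_coeffs_def)
  thus "(dirichlet_norm (power_series (truncate_coeffs d (taylor_coeff f))))\<^sup>2 \<le> (dirichlet_norm f)\<^sup>2"
    unfolding dirichlet_norm_sq[OF assms]
      power_series_in_dirichlet(2)[OF power_series_truncate(1) dirichlet_summable_truncate]
    by (intro add_mono) (auto simp: truncate_coeffs_def)
qed simp

lemma power_series_on_disk_shift:
  assumes "power_series_on_disk c"
  shows "power_series_on_disk (\<lambda>n. c (n + k))"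
  unfolding power_series_on_disk_def
proof
  fix z assume z: "z \<in> unit_disk"
  show "summable (\<lambda>n. c (n + k) * z ^ n)"
  proof (cases "z = 0")
    case False
    have "summable (\<lambda>n. c (n + k) * z ^ (n + k))"
      using assms z by (subst summable_iff_shift) (auto simp: power_series_on_disk_def)
    hence "summable (\<lambda>n. c (n + k) * z ^ (n + k) * inverse (z ^ k))" by (rule summable_mult2)
    moreover have "c (n + k) * z ^ (n + k) * inverse (z ^ k) = c (n + k) * z ^ n" for n
      using False by (simp add: power_add field_simps)
    ultimately show ?thesis by simp
  qed (auto intro: summable_finite[of "{0}"])
qed

text \<open>Working in \<open>ennreal\<close> permits infinite sums on the right, so that the bound
  can be integrated term by term before finiteness is known. The weight is n + 1 where the Bergman
  norm is wanted, and 1 for the inner series of the Hankel operator.\<close>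

lemma ennreal_Cauchy_Schwarz_sums:
  fixes g u :: "nat \<Rightarrow> complex" and w :: "nat \<Rightarrow> real"
  assumes "(\<lambda>n. g n * u n) sums s" "\<And>n. w n > 0"
  shows "ennreal ((cmod s)\<^sup>2) \<le> (\<Sum>n. ennreal ((cmod (g n))\<^sup>2 / w n)) * (\<Sum>n. ennreal (w n * (cmod (u n))\<^sup>2))"
    (is "_ \<le> ?A * ?B")
proof (rule tendsto_upperbound)
  show "(\<lambda>N. ennreal ((cmod (\<Sum>n<N. g n * u n))\<^sup>2)) \<longlonglongrightarrow> ennreal ((cmod s)\<^sup>2)"
    using assms(1) by (intro tendsto_intros) (auto simp: sums_def)
  have "ennreal ((cmod (\<Sum>n<N. g n * u n))\<^sup>2) \<le> ?A * ?B" for N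
  proof -
    have w: "w n \<noteq> 0" "w n \<ge> 0" for n using assms(2)[of n] by auto
    have "cmod (\<Sum>n<N. g n * u n) \<le> (\<Sum>n<N. (cmod (g n) / sqrt (w n)) * (sqrt (w n) * cmod (u n)))"
      by (rule order.trans[OF norm_sum], rule sum_mono) (simp add: norm_mult w)
    hence "(cmod (\<Sum>n<N. g n * u n))\<^sup>2 \<le> (\<Sum>n<N. (cmod (g n) / sqrt (w n)) * (sqrt (w n) * cmod (u n)))\<^sup>2"
      by (intro power_mono) auto
    also have "\<dots> \<le> (\<Sum>n<N. (cmod (g n) / sqrt (w n))\<^sup>2) * (\<Sum>n<N. (sqrt (w n) * cmod (u n))\<^sup>2)"
      by (rule Cauchy_Schwarz_ineq_sum)
    also have "\<dots> = (\<Sum>n<N. (cmod (g n))\<^sup>2 / w n) * (\<Sum>n<N. w n * (cmod (u n))\<^sup>2)"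
      using w by (simp add: power_divide power_mult_distrib)
    finally have "ennreal ((cmod (\<Sum>n<N. g n * u n))\<^sup>2) \<le>
        ennreal ((\<Sum>n<N. (cmod (g n))\<^sup>2 / w n) * (\<Sum>n<N. w n * (cmod (u n))\<^sup>2))" by (rule ennreal_leI)
    also have "\<dots> = (\<Sum>n<N. ennreal ((cmod (g n))\<^sup>2 / w n)) * (\<Sum>n<N. ennreal (w n * (cmod (u n))\<^sup>2))"
      using w by (subst ennreal_mult) (auto intro!: sum_nonneg)
    also have "\<dots> \<le> ?A * ?B"
      by (intro mult_mono sum_le_suminf) auto
    finally show ?thesis .
  qed
  thus "\<forall>\<^sub>F N in sequentially. ennreal ((cmod (\<Sum>n<N. g n * u n))\<^sup>2) \<le> ?A * ?B" by simp
qed simp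

section \<open>Big Hankel operators on the Bergman space\<close>

lemma continuous_on_monomial: "continuous_on A (\<lambda>z::complex. z ^ p * cnj z ^ q)"
  by (intro continuous_intros)

lemma disk_area_monomial:
  "integrable disk_area (\<lambda>z. z ^ p * cnj z ^ q)"
  "(LINT z|disk_area. z ^ p * cnj z ^ q) = (if p = q then of_real (1 / real (p + 1)) else 0)"
proof -
  show "integrable disk_area (\<lambda>z. z ^ p * cnj z ^ q)"
    by (rule integrable_disk_area_bounded[where B = 1])
       (auto simp: norm_mult norm_power intro!: mult_le_one power_le_one continuous_on_measurable_disk_area continuous_on_monomial)
  have "(LINT z|disk_area. z ^ p * cnj z ^ q) = (LINT z|disk_area. indicator (cball 0 1) z *\<^sub>R (z ^ p * cnj z ^ q))"
    by (intro Bochner_Integration.integral_cong) auto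
  also have "\<dots> = (if p = q then of_real (1 ^ (2 * p + 2) / real (p + 1)) else 0)"
    by (rule disk_area_moment) auto
  finally show "(LINT z|disk_area. z ^ p * cnj z ^ q) = (if p = q then of_real (1 / real (p + 1)) else 0)"
    by simp
qed

text \<open>The ratio of the inner product 1/(n+1) of z^n \<open>cnj z ^ k\<close> with z^(n-k) to
  the squared norm 1/(n-k+1) of the latter. For k > n the product is orthogonal to all z^m; the
  value 0 also neutralizes the truncated exponent \<open>n - k\<close> in
  \<open>big_hankel\<close>.\<close>

definition proj_coeff :: "nat \<Rightarrow> nat \<Rightarrow> real" where
  "proj_coeff n k = (if k \<le> n then real (n - k + 1) / real (n + 1) else 0)"

text \<open>The Bergman projection of \<open>cnj z ^ k * z ^ n\<close> is \<open>proj_coeff n k * z ^ (n - k)\<close>,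
  so this is the image of \<open>z ^ n\<close> under the big Hankel operator with symbol \<open>cnj z ^ k\<close>.\<close>
definition big_hankel :: "nat \<Rightarrow> nat \<Rightarrow> complex \<Rightarrow> complex" where
  "big_hankel n k z = z ^ n * cnj z ^ k - of_real (proj_coeff n k) * z ^ (n - k)"

text \<open>By Pythagoras, the squared norm of z^n \<open>cnj z ^ k\<close> minus that of its
  projection, the latter being the square of \<open>proj_coeff n k\<close> divided by n - k +
  1.\<close>

definition big_hankel_norm_sq :: "nat \<Rightarrow> nat \<Rightarrow> real" where
  "big_hankel_norm_sq n k = 1 / real (n + k + 1) - (if k \<le> n then real (n - k + 1) / (real (n + 1))\<^sup>2 else 0)"

lemma big_hankel_product:
  "big_hankel n k z * cnj (big_hankel n l z) =
     z ^ (n + l) * cnj z ^ (n + k) - of_real (proj_coeff n l) * (z ^ n * cnj z ^ (k + (n - l)))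
     - of_real (proj_coeff n k) * (z ^ (n - k + l) * cnj z ^ n)
     + of_real (proj_coeff n k * proj_coeff n l) * (z ^ (n - k) * cnj z ^ (n - l))"
  by (simp add: big_hankel_def power_add algebra_simps)

text \<open>The function \<open>big_hankel n k\<close> has angular frequency n - k, so different k
  give orthogonal functions. On the diagonal the two cross terms and the squared norm of the
  projection have the same size, which leaves a single subtraction.\<close>

lemma big_hankel_inner:
  "integrable disk_area (\<lambda>z. big_hankel n k z * cnj (big_hankel n l z))"
  "(LINT z|disk_area. big_hankel n k z * cnj (big_hankel n l z)) = (if k = l then of_real (big_hankel_norm_sq n k) else 0)"
proof -
  show "integrable disk_area (\<lambda>z. big_hankel n k z * cnj (big_hankel n l z))"
    unfolding big_hankel_product
    by (intro Bochner_Integration.integrable_add Bochner_Integration.integrable_diff integrable_mult_right disk_area_monomial(1))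
  have eq: "(LINT z|disk_area. big_hankel n k z * cnj (big_hankel n l z)) =
     (LINT z|disk_area. z ^ (n + l) * cnj z ^ (n + k))
     - of_real (proj_coeff n l) * (LINT z|disk_area. z ^ n * cnj z ^ (k + (n - l)))
     - of_real (proj_coeff n k) * (LINT z|disk_area. z ^ (n - k + l) * cnj z ^ n)
     + of_real (proj_coeff n k * proj_coeff n l) * (LINT z|disk_area. z ^ (n - k) * cnj z ^ (n - l))"
    unfolding big_hankel_product
    by (subst Bochner_Integration.integral_add Bochner_Integration.integral_diff;
        (intro Bochner_Integration.integrable_add Bochner_Integration.integrable_diff integrable_mult_right disk_area_monomial(1))?)+ simp
  show "(LINT z|disk_area. big_hankel n k z * cnj (big_hankel n l z)) = (if k = l then of_real (big_hankel_norm_sq n k) else 0)"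
  proof (cases "k = l")
    case False
    thus ?thesis unfolding eq disk_area_monomial(2) by (auto simp: proj_coeff_def)
  next
    case True
    show ?thesis
    proof (cases "k \<le> n")
      case False
      thus ?thesis unfolding eq disk_area_monomial(2) using True
        by (simp add: proj_coeff_def big_hankel_norm_sq_def)
    next
      case kn: True
      define B where "B = real (n - k + 1)"
      define N where "N = real (n + 1)"
      have pos: "B > 0" "N > 0" by (simp_all add: B_def N_def)
      have p: "proj_coeff n k = B / N" using kn by (simp add: proj_coeff_def B_def N_def)
      have "(LINT z|disk_area. big_hankel n k z * cnj (big_hankel n l z)) =
        of_real (1 / real (n + k + 1) - B / N * (1 / N) - B / N * (1 / N) + B / N * (B / N) * (1 / B))"
      proof -
        have i: "(LINT z|disk_area. z ^ (n + l) * cnj z ^ (n + k)) = of_real (1 / real (n + k + 1))"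
          and i2: "(LINT z|disk_area. z ^ n * cnj z ^ (k + (n - l))) = of_real (1 / N)"
          and i3: "(LINT z|disk_area. z ^ (n - k + l) * cnj z ^ n) = of_real (1 / N)"
          and i4: "(LINT z|disk_area. z ^ (n - k) * cnj z ^ (n - l)) = of_real (1 / B)"
          using True kn by (subst disk_area_monomial(2), simp add: N_def B_def)+
        show ?thesis unfolding eq i i2 i3 i4 by (simp add: p True[symmetric])
      qed
      also have "1 / real (n + k + 1) - B / N * (1 / N) - B / N * (1 / N) + B / N * (B / N) * (1 / B) = big_hankel_norm_sq n k"
      proof -
        have "B / N * (B / N) * (1 / B) = B / N\<^sup>2" "B / N * (1 / N) = B / N\<^sup>2"
          using pos by (simp_all add: power2_eq_square)
        thus ?thesis using kn unfolding big_hankel_norm_sq_def B_def[symmetric] N_def[symmetric]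
          by (simp only: if_True)
      qed
      finally show ?thesis using True by simp
    qed
  qed
qed

lemma integral_big_hankel_sq:
  "(LINT z|disk_area. (cmod (big_hankel n k z))\<^sup>2) = big_hankel_norm_sq n k"
proof -
  have "complex_of_real (LINT z|disk_area. (cmod (big_hankel n k z))\<^sup>2) =
    (LINT z|disk_area. big_hankel n k z * cnj (big_hankel n k z))"
    unfolding complex_norm_square[symmetric] by (rule integral_complex_of_real[symmetric])
  thus ?thesis unfolding big_hankel_inner by (simp only: simp_thms if_True of_real_eq_iff)
qed

text \<open>Each term is at most 1, so those with n < k contribute at most k. For n \<ge> k > 0 a
  term is at most k^2/(n(n+1)), which telescopes to at most k. The linear growth in k is the point:
  it matches the Dirichlet weight of the k-th coefficient.\<close>

lemma big_hankel_norm_sq_sum_le: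
  "(\<Sum>n<N. real (n + 1) * big_hankel_norm_sq n k) \<le> 2 * real k"
\<comment> \<open>For k = 0 every term vanishes, as z^n is its own projection; the telescoping bound
  would divide by n = 0.\<close>
proof (cases "k = 0")
  case True
  thus ?thesis by (auto intro!: sum_nonpos simp: big_hankel_norm_sq_def power2_eq_square)
next
  case k: False
  have le1: "real (n + 1) * big_hankel_norm_sq n k \<le> 1" for n
  proof -
    have "big_hankel_norm_sq n k \<le> 1 / real (n + k + 1)" by (simp add: big_hankel_norm_sq_def)
    also have "\<dots> \<le> 1 / real (n + 1)" by (simp add: field_simps)
    finally show ?thesis by (simp add: field_simps del: of_nat_add)
  qed
  have le2: "real (n + 1) * big_hankel_norm_sq n k \<le> (real k)\<^sup>2 * (1 / real n - 1 / real (Suc n))" if "n \<ge> k" for n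
  proof -
    have n: "real n > 0" using k that by simp
    have "real (n + 1) * big_hankel_norm_sq n k = (real n + 1) / (real n + real k + 1) - (real n - real k + 1) / (real n + 1)"
    proof -
      have "big_hankel_norm_sq n k = 1 / (real n + real k + 1) - (real n - real k + 1) / (real n + 1)\<^sup>2"
        using that by (simp add: big_hankel_norm_sq_def of_nat_diff add_ac)
      thus ?thesis by (simp add: right_diff_distrib power2_eq_square add.commute)
    qed
    also have "\<dots> = (real k)\<^sup>2 / ((real n + real k + 1) * (real n + 1))"
      using n by (simp add: divide_simps) (simp add: algebra_simps power2_eq_square)
    also have "\<dots> \<le> (real k)\<^sup>2 / (real n * (real n + 1))"
      using n by (intro divide_left_mono mult_right_mono mult_pos_pos) auto
    also have "\<dots> = (real k)\<^sup>2 * (1 / real n - 1 / real (Suc n))"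
      using n by (simp add: field_simps)
    finally show ?thesis .
  qed
  have A: "(\<Sum>n<M. real (n + 1) * big_hankel_norm_sq n k) \<le> real M" for M
    using sum_bounded_above[of "{..<M}" "\<lambda>n. real (n + 1) * big_hankel_norm_sq n k" 1] le1 by simp
  \<comment> \<open>The induction starts from k = 2k - k^2/k, the bound for the first k terms; each
    further term is at most one difference of the telescoping sum.\<close>
  have B: "(\<Sum>n<k + M. real (n + 1) * big_hankel_norm_sq n k) \<le> 2 * real k - (real k)\<^sup>2 / real (k + M)" for M
  proof (induction M)
    case 0
    thus ?case using A[of k] k by (simp add: power2_eq_square)
  next
    case (Suc M)
    have "(\<Sum>n<k + Suc M. real (n + 1) * big_hankel_norm_sq n k) =
      (\<Sum>n<k + M. real (n + 1) * big_hankel_norm_sq n k) + real (k + M + 1) * big_hankel_norm_sq (k + M) k" by simp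
    also have "\<dots> \<le> 2 * real k - (real k)\<^sup>2 / real (k + M) + (real k)\<^sup>2 * (1 / real (k + M) - 1 / real (Suc (k + M)))"
      by (intro add_mono Suc le2) simp
    also have "\<dots> = 2 * real k - (real k)\<^sup>2 / real (k + Suc M)" by (simp add: algebra_simps)
    finally show ?case .
  qed
  show ?thesis
  proof (cases "N \<le> k")
    case True
    thus ?thesis using A[of N] by linarith
  next
    case False
    then obtain M where N: "N = k + M" using le_Suc_ex nat_le_linear by blast
    have "(real k)\<^sup>2 / real (k + M) \<ge> 0" by simp
    thus ?thesis unfolding N using B[of M] by linarith
  qed
qed

text \<open>Hilbert--Schmidt bound for the big Hankel operator with symbol \<open>\<Sum>k<d. cnj (a k) * cnj z ^ k\<close>.\<close>
lemma big_hankel_hilbert_schmidt: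
  "(\<Sum>n. \<integral>\<^sup>+z. ennreal (real (n + 1) * (cmod (\<Sum>k<d. cnj (a k) * big_hankel n k z))\<^sup>2) \<partial>disk_area)
     \<le> ennreal (2 * (\<Sum>k<d. real k * (cmod (a k))\<^sup>2))"
proof -
  have int: "(\<integral>\<^sup>+z. ennreal (real (n + 1) * (cmod (\<Sum>k<d. cnj (a k) * big_hankel n k z))\<^sup>2) \<partial>disk_area) =
     ennreal (\<Sum>k<d. (cmod (a k))\<^sup>2 * (real (n + 1) * big_hankel_norm_sq n k))" for n
  proof -
    have orth: "(LINT z|disk_area. big_hankel n k z * cnj (big_hankel n l z)) = 0" if "k \<noteq> l" for k l
      using that by (simp only: big_hankel_inner if_False)
    note * = integral_cmod_sq_sum_orthogonal[where I = "{..<d}" and \<phi> = "big_hankel n" and c = "\<lambda>k. cnj (a k)" and M = disk_area,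
      OF finite_lessThan big_hankel_inner(1) orth, unfolded integral_big_hankel_sq]
    have "(\<integral>\<^sup>+z. ennreal (real (n + 1) * (cmod (\<Sum>k<d. cnj (a k) * big_hankel n k z))\<^sup>2) \<partial>disk_area) =
      ennreal (LINT z|disk_area. real (n + 1) * (cmod (\<Sum>k<d. cnj (a k) * big_hankel n k z))\<^sup>2)"
      by (intro nn_integral_eq_integral integrable_mult_right *(1)) auto
    also have "(LINT z|disk_area. real (n + 1) * (cmod (\<Sum>k<d. cnj (a k) * big_hankel n k z))\<^sup>2) =
      real (n + 1) * (\<Sum>k<d. (cmod (a k))\<^sup>2 * big_hankel_norm_sq n k)"
      using *(2) by (simp only: integral_mult_right_zero) simp
    finally show ?thesis by (simp add: sum_distrib_left algebra_simps)
  qed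
  \<comment> \<open>Nonnegativity is read off from \<open>big_hankel_norm_sq\<close> being the
    integral of a square; its formula does not show it.\<close>
  have nn: "(\<Sum>k<d. (cmod (a k))\<^sup>2 * (real (n + 1) * big_hankel_norm_sq n k)) \<ge> 0" for n
    unfolding integral_big_hankel_sq[symmetric] by (intro sum_nonneg mult_nonneg_nonneg integral_nonneg_AE) auto
  have "(\<Sum>n<N. \<integral>\<^sup>+z. ennreal (real (n + 1) * (cmod (\<Sum>k<d. cnj (a k) * big_hankel n k z))\<^sup>2) \<partial>disk_area)
     \<le> ennreal (2 * (\<Sum>k<d. real k * (cmod (a k))\<^sup>2))" for N
  proof -
    \<comment> \<open>Swapping the sums isolates, for each k, the Hilbert-Schmidt sum of the symbol
      \<open>cnj z ^ k\<close>.\<close>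
    have "(\<Sum>n<N. \<Sum>k<d. (cmod (a k))\<^sup>2 * (real (n + 1) * big_hankel_norm_sq n k)) =
      (\<Sum>k<d. (cmod (a k))\<^sup>2 * (\<Sum>n<N. real (n + 1) * big_hankel_norm_sq n k))"
      by (subst sum.swap) (simp add: sum_distrib_left)
    also have "\<dots> \<le> (\<Sum>k<d. (cmod (a k))\<^sup>2 * (2 * real k))"
      by (intro sum_mono mult_left_mono big_hankel_norm_sq_sum_le) auto
    also have "\<dots> = 2 * (\<Sum>k<d. real k * (cmod (a k))\<^sup>2)"
      by (simp add: sum_distrib_left algebra_simps)
    finally show ?thesis unfolding int using nn by (subst sum_ennreal) (auto intro: ennreal_leI)
  qed
  thus ?thesis by (intro suminf_le_const) auto
qed

text \<open>Pointwise splitting of \<open>cnj f * b'\<close> into projection and defect: b' is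
  expanded in its Taylor series and the defect of each monomial is a combination of the functions
  \<open>big_hankel n k\<close>. The sequence \<open>q\<close> holds the coefficients of the
  projection.\<close>

lemma small_hankel_decomposition:
  fixes a :: "nat \<Rightarrow> complex" and d :: nat
  assumes \<mu>: "power_series_on_disk \<mu>" and z: "cmod z < 1"
  defines "q \<equiv> \<lambda>j. real (j + 1) * (\<Sum>k<d. cnj (a k) * \<mu> (Suc j + k))"
  shows "(\<lambda>j. q j * z ^ j) sums power_series q z"
    and "(\<lambda>n. diffs \<mu> n * (\<Sum>k<d. cnj (a k) * big_hankel n k z)) sums
           (cnj (\<Sum>k<d. a k * z ^ k) * power_series (diffs \<mu>) z - power_series q z)"
proof -
  \<comment> \<open>\<open>T k\<close> is the projection of \<open>cnj z ^ k\<close> times the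
    derivative of \<open>power_series \<mu>\<close>: the coefficients of the primitive are shifted
    by k, then differentiated.\<close>
  define T where "T = (\<lambda>k. power_series (diffs (\<lambda>j. \<mu> (j + k))) z)"
  have T: "(\<lambda>j. diffs (\<lambda>j. \<mu> (j + k)) j * z ^ j) sums T k" for k
    unfolding T_def by (intro power_series_sums power_series_on_disk_diffs power_series_on_disk_shift \<mu> z)
  have "(\<lambda>j. \<Sum>k<d. cnj (a k) * (diffs (\<lambda>j. \<mu> (j + k)) j * z ^ j)) sums (\<Sum>k<d. cnj (a k) * T k)"
    by (intro sums_sum sums_mult T)
  also have "(\<lambda>j. \<Sum>k<d. cnj (a k) * (diffs (\<lambda>j. \<mu> (j + k)) j * z ^ j)) = (\<lambda>j. q j * z ^ j)"
    by (simp add: q_def diffs_def sum_distrib_left sum_distrib_right algebra_simps)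
  finally have q: "(\<lambda>j. q j * z ^ j) sums (\<Sum>k<d. cnj (a k) * T k)" .
  hence Q: "power_series q z = (\<Sum>k<d. cnj (a k) * T k)" by (simp add: power_series_def sums_iff)
  show "(\<lambda>j. q j * z ^ j) sums power_series q z" using q Q by simp
  have A: "(\<lambda>n. diffs \<mu> n * (of_real (proj_coeff n k) * z ^ (n - k))) sums T k" for k
  proof -
    have "diffs \<mu> (j + k) * (of_real (proj_coeff (j + k) k) * z ^ j) = diffs (\<lambda>j. \<mu> (j + k)) j * z ^ j" for j
    proof -
      have "proj_coeff (j + k) k = real (j + 1) / real (j + k + 1)" by (simp add: proj_coeff_def)
      hence "of_nat (j + k + 1) * complex_of_real (proj_coeff (j + k) k) = of_nat (j + 1)"
        by (simp del: of_nat_add of_nat_Suc)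
      hence "of_nat (j + k + 1) * complex_of_real (proj_coeff (j + k) k) * (\<mu> (j + k + 1) * z ^ j) = of_nat (j + 1) * (\<mu> (j + k + 1) * z ^ j)"
        by simp
      thus ?thesis by (simp add: diffs_def algebra_simps)
    qed
    hence "(\<lambda>j. diffs \<mu> (j + k) * (of_real (proj_coeff (j + k) k) * z ^ (j + k - k))) sums T k"
      using T[of k] by (simp only: add_diff_cancel_right')
    \<comment> \<open>The terms with n < k vanish because \<open>proj_coeff n k\<close> is 0 there,
      so reindexing by n = j + k loses nothing.\<close>
    thus ?thesis by (subst (asm) sums_zero_iff_shift) (auto simp: proj_coeff_def)
  qed
  have B: "(\<lambda>n. cnj z ^ k * (diffs \<mu> n * z ^ n)) sums (cnj z ^ k * power_series (diffs \<mu>) z)" for k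
    by (intro sums_mult power_series_sums power_series_on_disk_diffs \<mu> z)
  have "(\<lambda>n. \<Sum>k<d. cnj (a k) * (cnj z ^ k * (diffs \<mu> n * z ^ n) - diffs \<mu> n * (of_real (proj_coeff n k) * z ^ (n - k))))
    sums (\<Sum>k<d. cnj (a k) * (cnj z ^ k * power_series (diffs \<mu>) z - T k))"
    by (intro sums_sum sums_mult[OF sums_diff[OF B A]])
  also have "(\<lambda>n. \<Sum>k<d. cnj (a k) * (cnj z ^ k * (diffs \<mu> n * z ^ n) - diffs \<mu> n * (of_real (proj_coeff n k) * z ^ (n - k)))) =
    (\<lambda>n. diffs \<mu> n * (\<Sum>k<d. cnj (a k) * big_hankel n k z))"
    by (simp add: big_hankel_def sum_distrib_left algebra_simps)
  also have "(\<Sum>k<d. cnj (a k) * (cnj z ^ k * power_series (diffs \<mu>) z - T k)) =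
    cnj (\<Sum>k<d. a k * z ^ k) * power_series (diffs \<mu>) z - power_series q z"
    by (simp add: Q right_diff_distrib sum_subtractf sum_distrib_right mult.assoc)
  finally show "(\<lambda>n. diffs \<mu> n * (\<Sum>k<d. cnj (a k) * big_hankel n k z)) sums
           (cnj (\<Sum>k<d. a k * z ^ k) * power_series (diffs \<mu>) z - power_series q z)" .
qed

section \<open>Multiplication versus projected multiplication\<close>

text \<open>At each point z, Cauchy-Schwarz over n separates the coefficients of b' from the
  functions \<open>u n\<close>; after integration the second factor is the Hilbert-Schmidt sum. The
  factor 2 comes from (x + y)^2 \<le> 2 x^2 + 2 y^2, and 4 from combining it with the 2 in the
  Hilbert-Schmidt bound.\<close>

lemma multiplication_le_small_hankel:
  assumes \<mu>: "power_series_on_disk \<mu>" and G: "dirichlet_summable \<mu>"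
  shows "(\<integral>\<^sup>+z. ennreal ((cmod ((\<Sum>k<d. a k * z ^ k) * power_series (diffs \<mu>) z))\<^sup>2) \<partial>disk_area) \<le>
     2 * (\<Sum>j. ennreal (real (j + 1) * (cmod (\<Sum>k<d. cnj (a k) * \<mu> (Suc j + k)))\<^sup>2)) +
     ennreal (4 * dirichlet_sum \<mu> * (\<Sum>k<d. real k * (cmod (a k))\<^sup>2))"
proof -
  define q where "q = (\<lambda>j. real (j + 1) * (\<Sum>k<d. cnj (a k) * \<mu> (Suc j + k)))"
  define f where "f = (\<lambda>z. \<Sum>k<d. a k * z ^ k)"
  define u where "u = (\<lambda>n z. \<Sum>k<d. cnj (a k) * big_hankel n k z)"
  define g where "g = power_series (diffs \<mu>)"
  have dec: "(\<lambda>j. q j * z ^ j) sums power_series q z"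
      "(\<lambda>n. diffs \<mu> n * u n z) sums (cnj (f z) * g z - power_series q z)" if "cmod z < 1" for z
    unfolding q_def f_def u_def g_def by (rule small_hankel_decomposition[OF \<mu> that])+
  have q: "power_series_on_disk q"
    using sums_summable[OF dec(1)] by (simp add: power_series_on_disk_def)
  have [measurable]: "g \<in> borel_measurable disk_area" "power_series q \<in> borel_measurable disk_area"
    unfolding g_def by (intro measurable_power_series power_series_on_disk_diffs \<mu> q)+
  have [measurable]: "f \<in> borel_measurable disk_area" "u n \<in> borel_measurable disk_area" for n
    unfolding f_def u_def big_hankel_def by (intro continuous_on_measurable_disk_area continuous_intros)+
  have *: "ennreal ((cmod (f z * g z))\<^sup>2) \<le> 2 * ennreal ((cmod (power_series q z))\<^sup>2) +
     2 * (ennreal (dirichlet_sum \<mu>) * (\<Sum>n. ennreal (real (n + 1) * (cmod (u n z))\<^sup>2)))" if z: "cmod z < 1" for z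
  proof -
    let ?R = "cnj (f z) * g z - power_series q z"
    \<comment> \<open>With weights n + 1 the first factor is the squared Bergman norm of
      \<open>g\<close>, which is \<open>dirichlet_sum \<mu>\<close>.\<close>
    have "ennreal ((cmod ?R)\<^sup>2) \<le> (\<Sum>n. ennreal ((cmod (diffs \<mu> n))\<^sup>2 / real (n + 1))) * (\<Sum>n. ennreal (real (n + 1) * (cmod (u n z))\<^sup>2))"
      by (rule ennreal_Cauchy_Schwarz_sums[OF dec(2)[OF z]]) simp
    also have "(\<Sum>n. ennreal ((cmod (diffs \<mu> n))\<^sup>2 / real (n + 1))) = ennreal (dirichlet_sum \<mu>)"
      unfolding cmod_diffs_sq dirichlet_sum_def using G by (intro suminf_ennreal2) auto
    finally have R: "ennreal ((cmod ?R)\<^sup>2) \<le> ennreal (dirichlet_sum \<mu>) * (\<Sum>n. ennreal (real (n + 1) * (cmod (u n z))\<^sup>2))" .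
    \<comment> \<open>Only moduli matter, so \<open>f z\<close> may be replaced by its
      conjugate.\<close>
    have "cmod (f z * g z) = cmod (power_series q z + ?R)" by (simp add: norm_mult)
    also have "\<dots> \<le> cmod (power_series q z) + cmod ?R" by (rule norm_triangle_ineq)
    finally have "(cmod (f z * g z))\<^sup>2 \<le> (cmod (power_series q z) + cmod ?R)\<^sup>2" by (intro power_mono) auto
    also have "\<dots> \<le> 2 * (cmod (power_series q z))\<^sup>2 + 2 * (cmod ?R)\<^sup>2"
      using sum_squares_bound[of "cmod (power_series q z)" "cmod ?R"] by (simp add: power2_sum)
    finally have "ennreal ((cmod (f z * g z))\<^sup>2) \<le> ennreal (2 * (cmod (power_series q z))\<^sup>2 + 2 * (cmod ?R)\<^sup>2)"
      by (rule ennreal_leI)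
    also have "\<dots> = 2 * ennreal ((cmod (power_series q z))\<^sup>2) + 2 * ennreal ((cmod ?R)\<^sup>2)"
      by (simp add: ennreal_plus ennreal_mult)
    also have "\<dots> \<le> 2 * ennreal ((cmod (power_series q z))\<^sup>2) +
     2 * (ennreal (dirichlet_sum \<mu>) * (\<Sum>n. ennreal (real (n + 1) * (cmod (u n z))\<^sup>2)))"
      by (intro add_left_mono mult_left_mono R) auto
    finally show ?thesis .
  qed
  have "(\<integral>\<^sup>+z. ennreal ((cmod (f z * g z))\<^sup>2) \<partial>disk_area) \<le>
    (\<integral>\<^sup>+z. 2 * ennreal ((cmod (power_series q z))\<^sup>2) +
     2 * (ennreal (dirichlet_sum \<mu>) * (\<Sum>n. ennreal (real (n + 1) * (cmod (u n z))\<^sup>2))) \<partial>disk_area)"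
    by (intro nn_integral_mono *) simp
  also have "\<dots> = 2 * (\<integral>\<^sup>+z. ennreal ((cmod (power_series q z))\<^sup>2) \<partial>disk_area) +
     2 * (ennreal (dirichlet_sum \<mu>) * (\<Sum>n. \<integral>\<^sup>+z. ennreal (real (n + 1) * (cmod (u n z))\<^sup>2) \<partial>disk_area))"
    by (simp add: nn_integral_add nn_integral_cmult nn_integral_suminf)
  also have "\<dots> \<le> 2 * (\<integral>\<^sup>+z. ennreal ((cmod (power_series q z))\<^sup>2) \<partial>disk_area) +
     2 * (ennreal (dirichlet_sum \<mu>) * ennreal (2 * (\<Sum>k<d. real k * (cmod (a k))\<^sup>2)))"
    unfolding u_def by (intro add_left_mono mult_left_mono big_hankel_hilbert_schmidt) auto
  also have "2 * (ennreal (dirichlet_sum \<mu>) * ennreal (2 * (\<Sum>k<d. real k * (cmod (a k))\<^sup>2))) =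
      ennreal (4 * dirichlet_sum \<mu> * (\<Sum>k<d. real k * (cmod (a k))\<^sup>2))"
  proof -
    have "ennreal (4 * dirichlet_sum \<mu> * (\<Sum>k<d. real k * (cmod (a k))\<^sup>2)) =
      ennreal (2 * (dirichlet_sum \<mu> * (2 * (\<Sum>k<d. real k * (cmod (a k))\<^sup>2))))" by (simp add: algebra_simps)
    also have "\<dots> = 2 * (ennreal (dirichlet_sum \<mu>) * ennreal (2 * (\<Sum>k<d. real k * (cmod (a k))\<^sup>2)))"
      using dirichlet_sum_nonneg[OF G] by (subst ennreal_mult, simp, simp add: sum_nonneg)+ simp
    finally show ?thesis by simp
  qed
  also have "(\<integral>\<^sup>+z. ennreal ((cmod (power_series q z))\<^sup>2) \<partial>disk_area) =
    (\<Sum>j. ennreal (real (j + 1) * (cmod (\<Sum>k<d. cnj (a k) * \<mu> (Suc j + k)))\<^sup>2))"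
  proof -
    have "(cmod (q j))\<^sup>2 / real (j + 1) = real (j + 1) * (cmod (\<Sum>k<d. cnj (a k) * \<mu> (Suc j + k)))\<^sup>2" for j
      unfolding q_def norm_mult norm_of_real by (simp add: power_mult_distrib power2_eq_square del: of_nat_Suc of_nat_add)
    thus ?thesis unfolding nn_integral_cmod_sq_power_series[OF q] by simp
  qed
  finally show ?thesis unfolding f_def g_def .
qed

text \<open>Serves two variational arguments: taking \<open>w\<close> to be an inner product forces
  that product to vanish, and \<open>w = -1\<close> gives a Bessel inequality.\<close>

lemma cmod_add_scaled_sq:
  "(cmod (a + w * b))\<^sup>2 = (cmod a)\<^sup>2 + 2 * Re (cnj w * (a * cnj b)) + (cmod w)\<^sup>2 * (cmod b)\<^sup>2"
  unfolding cmod_power2 by (simp add: power2_eq_square algebra_simps)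

text \<open>Parseval's identity yields the inner products by polarization. Let w be the inner
  product with z^m of the series without its m-th term. Adding w z^m raises the squared norm by
  |w|^2/(m+1) according to Parseval, but by 2|w|^2 + |w|^2/(m+1) when the square is expanded; hence
  w = 0.\<close>

lemma integral_power_series_monomial:
  assumes c: "power_series_on_disk c" and s: "summable (\<lambda>n. (cmod (c n))\<^sup>2 / real (n + 1))"
  shows "integrable disk_area (\<lambda>z. power_series c z * cnj z ^ m)"
    and "(LINT z|disk_area. power_series c z * cnj z ^ m) = c m / of_nat (m + 1)"
proof -
  \<comment> \<open>\<open>e 0\<close> is the part to be shown orthogonal to z^m, and
    \<open>e (c m)\<close> is \<open>c\<close> itself.\<close>
  define e where "e = (\<lambda>t. c(m := t))"
  have e: "(\<lambda>n. e t n * z ^ n) sums (power_series c z + (t - c m) * z ^ m)" if "cmod z < 1" for z t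
  proof -
    have "(\<lambda>n. c n * z ^ n + (if n = m then (t - c m) * z ^ n else 0)) sums (power_series c z + (t - c m) * z ^ m)"
      by (intro sums_add power_series_sums c that sums_single)
    also have "(\<lambda>n. c n * z ^ n + (if n = m then (t - c m) * z ^ n else 0)) = (\<lambda>n. e t n * z ^ n)"
      by (auto simp: e_def algebra_simps)
    finally show ?thesis .
  qed
  have ed: "power_series_on_disk (e t)" for t using e by (auto simp: power_series_on_disk_def sums_iff)
  have ev: "power_series (e t) z = power_series (e 0) z + t * z ^ m" if "cmod z < 1" for z t
  proof -
    have h: "power_series (e t) z = power_series c z + (t - c m) * z ^ m" for t
      using e[OF that, of t] by (simp add: power_series_def sums_iff)
    show ?thesis by (simp add: h[of t] h[of 0] algebra_simps)
  qed
  have e0: "summable (\<lambda>n. (cmod (e 0 n))\<^sup>2 / real (n + 1))"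
    by (rule summable_comparison_test[OF _ s]) (auto simp: e_def)
  have es: "(\<lambda>n. (cmod (e t n))\<^sup>2 / real (n + 1)) sums ((\<Sum>n. (cmod (e 0 n))\<^sup>2 / real (n + 1)) + (cmod t)\<^sup>2 / real (m + 1))" for t
  proof -
    have "(\<lambda>n. (cmod (e 0 n))\<^sup>2 / real (n + 1) + (if n = m then (cmod t)\<^sup>2 / real (n + 1) else 0)) sums
       ((\<Sum>n. (cmod (e 0 n))\<^sup>2 / real (n + 1)) + (cmod t)\<^sup>2 / real (m + 1))"
      by (intro sums_add summable_sums e0 sums_single)
    also have "(\<lambda>n. (cmod (e 0 n))\<^sup>2 / real (n + 1) + (if n = m then (cmod t)\<^sup>2 / real (n + 1) else 0)) = (\<lambda>n. (cmod (e t n))\<^sup>2 / real (n + 1))"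
      by (auto simp: e_def)
    finally show ?thesis .
  qed
  have norm: "integrable disk_area (\<lambda>z. (cmod (power_series (e t) z))\<^sup>2)"
     "(LINT z|disk_area. (cmod (power_series (e t) z))\<^sup>2) = (\<Sum>n. (cmod (e 0 n))\<^sup>2 / real (n + 1)) + (cmod t)\<^sup>2 / real (m + 1)" for t
    using power_series_integral[OF ed sums_summable[OF es]] es[of t] by (simp_all add: sums_iff)
  note [measurable] = measurable_power_series[OF ed]
  have [measurable]: "(\<lambda>z. cnj z ^ m) \<in> borel_measurable disk_area"
    by (intro continuous_on_measurable_disk_area continuous_intros)
  \<comment> \<open>On a finite measure space, x \<le> 1 + x^2 makes square integrable functions
    integrable.\<close>
  have int: "integrable disk_area (\<lambda>z. power_series (e t) z * cnj z ^ m)" for t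
  proof (rule Bochner_Integration.integrable_bound[where f = "\<lambda>z. 1 + (cmod (power_series (e t) z))\<^sup>2"])
    show "integrable disk_area (\<lambda>z. 1 + (cmod (power_series (e t) z))\<^sup>2)" using norm by simp
    have "cmod (power_series (e t) z * cnj z ^ m) \<le> 1 + (cmod (power_series (e t) z))\<^sup>2" if "cmod z < 1" for z
    proof -
      have "cmod (power_series (e t) z * cnj z ^ m) \<le> cmod (power_series (e t) z) * 1"
        unfolding norm_mult norm_power complex_mod_cnj using that by (intro mult_left_mono power_le_one) auto
      also have "\<dots> \<le> 1 + (cmod (power_series (e t) z))\<^sup>2"
        using sum_squares_bound[of 1 "cmod (power_series (e t) z)"] norm_ge_zero[of "power_series (e t) z"] by (simp, linarith)
      finally show ?thesis .
    qed
    thus "AE z in disk_area. norm (power_series (e t) z * cnj z ^ m) \<le> norm (1 + (cmod (power_series (e t) z))\<^sup>2)"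
      by (intro AE_I2) auto
  qed measurable
  define w where "w = (LINT z|disk_area. power_series (e 0) z * cnj z ^ m)"
  have re: "(LINT z|disk_area. Re (cnj w * (power_series (e 0) z * cnj z ^ m))) = (cmod w)\<^sup>2"
  proof -
    have "(LINT z|disk_area. Re (cnj w * (power_series (e 0) z * cnj z ^ m))) = Re (LINT z|disk_area. cnj w * (power_series (e 0) z * cnj z ^ m))"
      by (intro integral_Re integrable_mult_right int)
    also have "\<dots> = Re (of_real ((cmod w)\<^sup>2))"
      unfolding integral_mult_right_zero w_def[symmetric] complex_norm_square by (simp only: mult.commute)
    finally show ?thesis by simp
  qed
  have mono: "integrable disk_area (\<lambda>z. (cmod w)\<^sup>2 * (cmod (z ^ m))\<^sup>2)"
       "(LINT z|disk_area. (cmod w)\<^sup>2 * (cmod (z ^ m))\<^sup>2) = (cmod w)\<^sup>2 / real (m + 1)"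
  proof -
    show "integrable disk_area (\<lambda>z. (cmod w)\<^sup>2 * (cmod (z ^ m))\<^sup>2)"
      by (intro integrable_mult_right integrable_disk_area_bounded[where B = 1]
            continuous_on_measurable_disk_area continuous_intros)
         (auto simp: norm_power intro!: power_le_one)
    have "(LINT z|disk_area. (cmod (z ^ m))\<^sup>2) = (LINT z|disk_area. indicator (cball 0 1) z * ((cmod z)\<^sup>2) ^ m)"
      by (intro Bochner_Integration.integral_cong) (auto simp: norm_power power_mult[symmetric] mult.commute)
    also have "\<dots> = 1 / real (m + 1)" using disk_area_moment_diag[of 1 m] by simp
    finally show "(LINT z|disk_area. (cmod w)\<^sup>2 * (cmod (z ^ m))\<^sup>2) = (cmod w)\<^sup>2 / real (m + 1)" by simp
  qed
  have "(\<Sum>n. (cmod (e 0 n))\<^sup>2 / real (n + 1)) + (cmod w)\<^sup>2 / real (m + 1) =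
    (LINT z|disk_area. (cmod (power_series (e 0) z))\<^sup>2 + 2 * Re (cnj w * (power_series (e 0) z * cnj z ^ m)) + (cmod w)\<^sup>2 * (cmod (z ^ m))\<^sup>2)"
    unfolding norm(2)[of w, symmetric]
  proof (intro Bochner_Integration.integral_cong refl)
    fix z assume "z \<in> space disk_area"
    hence z: "cmod z < 1" by simp
    show "(cmod (power_series (e w) z))\<^sup>2 = (cmod (power_series (e 0) z))\<^sup>2 + 2 * Re (cnj w * (power_series (e 0) z * cnj z ^ m)) + (cmod w)\<^sup>2 * (cmod (z ^ m))\<^sup>2"
      unfolding ev[OF z, of w] cmod_add_scaled_sq by simp
  qed
  also have "\<dots> = (\<Sum>n. (cmod (e 0 n))\<^sup>2 / real (n + 1)) + 2 * (cmod w)\<^sup>2 + (cmod w)\<^sup>2 / real (m + 1)"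
  proof -
    have i: "integrable disk_area (\<lambda>z. 2 * Re (cnj w * (power_series (e 0) z * cnj z ^ m)))"
      by (intro integrable_mult_right integrable_Re int)
    show ?thesis
      unfolding Bochner_Integration.integral_add[OF Bochner_Integration.integrable_add[OF norm(1)[of 0] i] mono(1)]
        Bochner_Integration.integral_add[OF norm(1)[of 0] i] integral_mult_right_zero[of _ 2] re mono(2) norm(2)
      by simp
  qed
  finally have w0: "w = 0" by simp
  have pc: "power_series c z * cnj z ^ m = power_series (e 0) z * cnj z ^ m + c m * (z ^ m * cnj z ^ m)" if "cmod z < 1" for z
    using ev[OF that, of "c m"] by (simp add: e_def algebra_simps)
  have "integrable disk_area (\<lambda>z. power_series (e (c m)) z * cnj z ^ m)" by (rule int)
  thus "integrable disk_area (\<lambda>z. power_series c z * cnj z ^ m)" by (simp add: e_def)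
  have "(LINT z|disk_area. power_series c z * cnj z ^ m) = (LINT z|disk_area. power_series (e 0) z * cnj z ^ m + c m * (z ^ m * cnj z ^ m))"
    using pc by (intro Bochner_Integration.integral_cong) auto
  also have "\<dots> = w + c m * (LINT z|disk_area. z ^ m * cnj z ^ m)"
    unfolding w_def by (subst Bochner_Integration.integral_add[OF int integrable_mult_right[OF disk_area_monomial(1)]]) simp
  also have "\<dots> = c m / of_nat (m + 1)" using w0 by (simp add: disk_area_monomial(2))
  finally show "(LINT z|disk_area. power_series c z * cnj z ^ m) = c m / of_nat (m + 1)" .
qed

text \<open>That the projection is a contraction is shown as a Bessel inequality. The polynomial
  \<open>p\<close> consists of the first J terms of the projection of \<open>cnj f * g\<close>; its
  inner product with \<open>cnj f * g\<close> equals its own squared norm X, and expanding the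
  square of |\<open>cnj f * g - p\<close>| gives the bound.\<close>

lemma small_hankel_le_multiplication:
  assumes \<mu>: "power_series_on_disk \<mu>" and G: "dirichlet_summable \<mu>"
  shows "integrable disk_area (\<lambda>z. (cmod ((\<Sum>k<d. a k * z ^ k) * power_series (diffs \<mu>) z))\<^sup>2)"
    and "(\<Sum>j<J. real (j + 1) * (cmod (\<Sum>k<d. cnj (a k) * \<mu> (Suc j + k)))\<^sup>2) \<le>
     (LINT z|disk_area. (cmod ((\<Sum>k<d. a k * z ^ k) * power_series (diffs \<mu>) z))\<^sup>2)"
proof -
  define S where "S = (\<lambda>j. \<Sum>k<d. cnj (a k) * \<mu> (Suc j + k))"
  define q where "q = (\<lambda>j. of_nat (j + 1) * S j)"
  define f where "f = (\<lambda>z. \<Sum>k<d. a k * z ^ k)"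
  define p where "p = (\<lambda>z. \<Sum>j<J. q j * z ^ j)"
  define g where "g = power_series (diffs \<mu>)"
  define X where "X = (\<Sum>j<J. real (j + 1) * (cmod (S j))\<^sup>2)"
  have d\<mu>: "power_series_on_disk (diffs \<mu>)" "summable (\<lambda>n. (cmod (diffs \<mu> n))\<^sup>2 / real (n + 1))"
    unfolding cmod_diffs_sq by (intro power_series_on_disk_diffs \<mu> G)+
  have [measurable]: "g \<in> borel_measurable disk_area"
    unfolding g_def by (intro measurable_power_series d\<mu>)
  have [measurable]: "f \<in> borel_measurable disk_area"
    unfolding f_def by (intro continuous_on_measurable_disk_area continuous_intros)
  have g2: "integrable disk_area (\<lambda>z. (cmod (g z))\<^sup>2)"
    unfolding g_def by (rule power_series_integral[OF d\<mu>])
  \<comment> \<open>The factor m + 1 from differentiation cancels against the moment 1/(m + 1). With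
    m = j + k this leaves \<mu>_(j+k+1), which is where the Hankel matrix comes from.\<close>
  have gm: "integrable disk_area (\<lambda>z. g z * cnj z ^ m)" "(LINT z|disk_area. g z * cnj z ^ m) = \<mu> (Suc m)" for m
    using integral_power_series_monomial[OF d\<mu>, of m] unfolding g_def
    by (simp_all add: diffs_def del: of_nat_Suc)
  \<comment> \<open>The polynomial \<open>f\<close> is bounded on the disk by the sum of the moduli
    of its coefficients.\<close>
  have fg: "integrable disk_area (\<lambda>z. (cmod (f z * g z))\<^sup>2)"
  proof (rule Bochner_Integration.integrable_bound)
    show "integrable disk_area (\<lambda>z. (\<Sum>k<d. cmod (a k))\<^sup>2 * (cmod (g z))\<^sup>2)"
      by (intro integrable_mult_right g2)
    have "cmod (f z) \<le> (\<Sum>k<d. cmod (a k))" if "cmod z < 1" for z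
      unfolding f_def using that
      by (intro sum_norm_le) (auto simp: norm_mult norm_power intro!: mult_left_le power_le_one)
    hence "(cmod (f z))\<^sup>2 * (cmod (g z))\<^sup>2 \<le> (\<Sum>k<d. cmod (a k))\<^sup>2 * (cmod (g z))\<^sup>2" if "cmod z < 1" for z
      using that by (intro mult_right_mono power_mono) auto
    thus "AE z in disk_area. norm ((cmod (f z * g z))\<^sup>2) \<le> norm ((\<Sum>k<d. cmod (a k))\<^sup>2 * (cmod (g z))\<^sup>2)"
      by (intro AE_I2) (auto simp: norm_mult power_mult_distrib)
  qed measurable
  have h_eq: "cnj (f z) * g z * cnj (p z) = (\<Sum>j<J. \<Sum>k<d. cnj (q j) * cnj (a k) * (g z * cnj z ^ (j + k)))" for z
  proof -
    have "cnj (f z) * g z * cnj (p z) = (\<Sum>j<J. cnj (q j) * cnj z ^ j) * (\<Sum>k<d. cnj (a k) * cnj z ^ k) * g z"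
      by (simp add: f_def p_def mult_ac)
    also have "\<dots> = (\<Sum>j<J. \<Sum>k<d. cnj (q j) * cnj (a k) * (g z * cnj z ^ (j + k)))"
      unfolding sum_product by (simp add: sum_distrib_left power_add mult_ac)
    finally show ?thesis .
  qed
  have h: "integrable disk_area (\<lambda>z. cnj (f z) * g z * cnj (p z))"
    unfolding h_eq by (intro Bochner_Integration.integrable_sum integrable_mult_right gm)
  have "(LINT z|disk_area. cnj (f z) * g z * cnj (p z)) = (\<Sum>j<J. \<Sum>k<d. cnj (q j) * cnj (a k) * \<mu> (Suc (j + k)))"
    unfolding h_eq by (simp add: Bochner_Integration.integral_sum Bochner_Integration.integrable_sum gm)
  also have "\<dots> = (\<Sum>j<J. cnj (q j) * S j)"
    by (simp add: S_def sum_distrib_left mult_ac)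
  also have "\<dots> = (\<Sum>j<J. of_real (real (j + 1) * (cmod (S j))\<^sup>2))"
  proof (intro sum.cong refl)
    fix j
    have "cnj (q j) * S j = of_nat (j + 1) * (S j * cnj (S j))" by (simp add: q_def algebra_simps)
    also have "\<dots> = of_real (real (j + 1) * (cmod (S j))\<^sup>2)" by (simp add: complex_norm_square[symmetric])
    finally show "cnj (q j) * S j = of_real (real (j + 1) * (cmod (S j))\<^sup>2)" .
  qed
  also have "\<dots> = of_real X" by (simp add: X_def)
  finally have hX: "(LINT z|disk_area. Re (cnj (f z) * g z * cnj (p z))) = X"
    using h by (subst integral_Re) auto
  have p: "integrable disk_area (\<lambda>z. (cmod (p z))\<^sup>2)" "(LINT z|disk_area. (cmod (p z))\<^sup>2) = X"
  proof -
    have ind: "indicator (cball 0 1) z * (cmod (p z))\<^sup>2 = (cmod (p z))\<^sup>2" if "z \<in> space disk_area" for z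
      using that by simp
    have "integrable disk_area (\<lambda>z. indicator (cball 0 1) z * (cmod (p z))\<^sup>2)"
      unfolding p_def by (rule integral_cmod_sq_polynomial) auto
    also have "?this \<longleftrightarrow> integrable disk_area (\<lambda>z. (cmod (p z))\<^sup>2)"
      by (intro Bochner_Integration.integrable_cong refl ind)
    finally show "integrable disk_area (\<lambda>z. (cmod (p z))\<^sup>2)" .
    have "(LINT z|disk_area. (cmod (p z))\<^sup>2) = (LINT z|disk_area. indicator (cball 0 1) z * (cmod (p z))\<^sup>2)"
      by (intro Bochner_Integration.integral_cong refl ind[symmetric])
    also have "\<dots> = (\<Sum>j<J. (cmod (q j))\<^sup>2 * (1 ^ (2 * j + 2) / real (j + 1)))"
      unfolding p_def by (rule integral_cmod_sq_polynomial) auto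
    also have "\<dots> = X" unfolding X_def q_def norm_mult norm_of_nat
      by (intro sum.cong) (simp_all add: power_mult_distrib power2_eq_square del: of_nat_Suc of_nat_add)
    finally show "(LINT z|disk_area. (cmod (p z))\<^sup>2) = X" .
  qed
  \<comment> \<open>The left side is 2X - X = X.\<close>
  have "(LINT z|disk_area. 2 * Re (cnj (f z) * g z * cnj (p z)) - (cmod (p z))\<^sup>2) \<le> (LINT z|disk_area. (cmod (f z * g z))\<^sup>2)"
  proof (intro integral_mono fg Bochner_Integration.integrable_diff integrable_mult_right integrable_Re h p)
    fix z
    have "0 \<le> (cmod (cnj (f z) * g z + (-1) * p z))\<^sup>2" by simp
    also have "\<dots> = (cmod (f z * g z))\<^sup>2 - 2 * Re (cnj (f z) * g z * cnj (p z)) + (cmod (p z))\<^sup>2"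
      unfolding cmod_add_scaled_sq by (simp add: norm_mult)
    finally show "2 * Re (cnj (f z) * g z * cnj (p z)) - (cmod (p z))\<^sup>2 \<le> (cmod (f z * g z))\<^sup>2" by simp
  qed
  also have "(LINT z|disk_area. 2 * Re (cnj (f z) * g z * cnj (p z)) - (cmod (p z))\<^sup>2) = X"
    unfolding Bochner_Integration.integral_diff[OF integrable_mult_right[OF integrable_Re[OF h]] p(1)]
      integral_mult_right_zero[of _ 2] hX p(2) by simp
  finally show "(\<Sum>j<J. real (j + 1) * (cmod (\<Sum>k<d. cnj (a k) * \<mu> (Suc j + k)))\<^sup>2) \<le>
     (LINT z|disk_area. (cmod ((\<Sum>k<d. a k * z ^ k) * power_series (diffs \<mu>) z))\<^sup>2)"
    unfolding X_def S_def f_def g_def .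
  show "integrable disk_area (\<lambda>z. (cmod ((\<Sum>k<d. a k * z ^ k) * power_series (diffs \<mu>) z))\<^sup>2)"
    using fg unfolding f_def g_def .
qed

section \<open>From polynomials to the whole Dirichlet space: the two implications\<close>

lemma hankel_coeff_truncate:
  "hankel_coeff lam (power_series (truncate_coeffs d a)) n = (\<Sum>k<d. lam (n + k) * a k)"
proof -
  have "(\<Sum>k. lam (n + k) * truncate_coeffs d a k) = (\<Sum>k<d. lam (n + k) * truncate_coeffs d a k)"
    by (rule suminf_finite) (auto simp: truncate_coeffs_def)
  thus ?thesis by (simp add: hankel_coeff_def taylor_coeff_power_series power_series_truncate(1) truncate_coeffs_def)
qed

lemma dirichlet_sum_truncate:
  "dirichlet_sum (truncate_coeffs d a) = (\<Sum>k<d. real k * (cmod (a k))\<^sup>2)"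
proof -
  define h where "h = (\<lambda>k. real k * (cmod (truncate_coeffs d a k))\<^sup>2)"
  have "summable h" by (rule summable_finite[of "{..<d}"]) (auto simp: h_def truncate_coeffs_def)
  hence "(\<Sum>n. h (Suc n)) = suminf h" using suminf_split_head[of h] by (simp add: h_def)
  also have "\<dots> = (\<Sum>k<d. h k)" by (rule suminf_finite) (auto simp: h_def truncate_coeffs_def)
  finally show ?thesis by (simp add: dirichlet_sum_def h_def truncate_coeffs_def)
qed

lemma power_series_on_disk_cnj:
  assumes "power_series_on_disk c"
  shows "power_series_on_disk (\<lambda>n. cnj (c n))"
  unfolding power_series_on_disk_def
proof
  fix z assume "z \<in> unit_disk"
  hence "(\<lambda>n. c n * cnj z ^ n) sums power_series c (cnj z)" by (intro power_series_sums assms) simp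
  hence "(\<lambda>n. cnj (c n * cnj z ^ n)) sums cnj (power_series c (cnj z))" by (simp only: sums_cnj)
  thus "summable (\<lambda>n. cnj (c n) * z ^ n)" by (simp add: sums_iff)
qed

abbreviation symbol_measure :: "(nat \<Rightarrow> complex) \<Rightarrow> complex measure" where
  "symbol_measure \<mu> \<equiv> density disk_area (\<lambda>z. ennreal ((cmod (deriv (power_series \<mu>) z))\<^sup>2))"

lemma nn_integral_symbol_measure:
  assumes \<mu>: "power_series_on_disk \<mu>" and f: "f \<in> borel_measurable disk_area"
  shows "(\<integral>\<^sup>+z. ennreal ((cmod (f z))\<^sup>2) \<partial>symbol_measure \<mu>) =
    (\<integral>\<^sup>+z. ennreal ((cmod (f z * power_series (diffs \<mu>) z))\<^sup>2) \<partial>disk_area)"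
proof -
  note [measurable] = f measurable_deriv_disk_area[OF power_series_holomorphic[OF \<mu>]]
  have "(\<integral>\<^sup>+z. ennreal ((cmod (f z))\<^sup>2) \<partial>symbol_measure \<mu>) =
    (\<integral>\<^sup>+z. ennreal ((cmod (deriv (power_series \<mu>) z))\<^sup>2) * ennreal ((cmod (f z))\<^sup>2) \<partial>disk_area)"
    by (rule nn_integral_density) measurable
  also have "\<dots> = (\<integral>\<^sup>+z. ennreal ((cmod (f z * power_series (diffs \<mu>) z))\<^sup>2) \<partial>disk_area)"
    using power_series_has_field_derivative[OF \<mu>, THEN DERIV_imp_deriv]
    by (intro nn_integral_cong) (simp add: norm_mult power_mult_distrib ennreal_mult' mult.commute)
  finally show ?thesis .
qed

lemma dirichlet_measurable: "f \<in> dirichlet_space \<Longrightarrow> f \<in> borel_measurable disk_area"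
  unfolding dirichlet_space_def
  by (intro continuous_on_measurable_disk_area holomorphic_on_imp_continuous_on) simp

lemma dirichlet_norm_sq_bounds:
  assumes "f \<in> dirichlet_space"
  shows "dirichlet_sum (taylor_coeff f) \<le> (dirichlet_norm f)\<^sup>2" "(cmod (taylor_coeff f 0))\<^sup>2 \<le> (dirichlet_norm f)\<^sup>2"
  using dirichlet_norm_sq[OF assms] assms dirichlet_sum_nonneg[of "taylor_coeff f"]
  by (auto simp: dirichlet_space_iff)

text \<open>The coefficients of H 1 are \<open>lam\<close>. Well-definedness of H 1 therefore gives
  convergence of the symbol, and its norm bound gives \<open>dirichlet_sum \<mu> \<le> C^2\<close>,
  which controls the defect term.\<close>

lemma bounded_imp_carleson:
  assumes "hankel_bounded_on_dirichlet lam"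
  shows "power_series_on_disk (\<lambda>n. cnj (lam n))" "dirichlet_carleson (symbol_measure (\<lambda>n. cnj (lam n)))"
proof -
  obtain C where wd: "\<And>f. f \<in> dirichlet_space \<Longrightarrow> hankel_well_defined lam f" and C: "C > 0"
    and mem: "\<And>f. f \<in> dirichlet_space \<Longrightarrow> hankel_op lam f \<in> dirichlet_space"
    and bd: "\<And>f. f \<in> dirichlet_space \<Longrightarrow> dirichlet_norm (hankel_op lam f) \<le> C * dirichlet_norm f"
    using assms unfolding hankel_bounded_on_dirichlet_def by metis
  define \<mu> where "\<mu> = (\<lambda>n. cnj (lam n))"
  have hc: "power_series_on_disk (hankel_coeff lam f)" "dirichlet_summable (hankel_coeff lam f)"
     "dirichlet_sum (hankel_coeff lam f) \<le> C\<^sup>2 * (dirichlet_norm f)\<^sup>2" if f: "f \<in> dirichlet_space" for f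
  proof -
    show 1: "power_series_on_disk (hankel_coeff lam f)" using wd[OF f] by (simp add: hankel_well_defined_def)
    have t: "taylor_coeff (hankel_op lam f) n = hankel_coeff lam f n" for n
      unfolding hankel_op_def by (rule taylor_coeff_power_series[OF 1])
    show "dirichlet_summable (hankel_coeff lam f)" using mem[OF f] by (simp add: dirichlet_space_iff t)
    have "dirichlet_sum (hankel_coeff lam f) \<le> (dirichlet_norm (hankel_op lam f))\<^sup>2"
      using dirichlet_norm_sq_bounds(1)[OF mem[OF f]] by (simp add: dirichlet_sum_def t)
    also have "\<dots> \<le> (C * dirichlet_norm f)\<^sup>2" using bd[OF f] by (intro power_mono) auto
    finally show "dirichlet_sum (hankel_coeff lam f) \<le> C\<^sup>2 * (dirichlet_norm f)\<^sup>2" by (simp add: power_mult_distrib)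
  qed
  define one where "one = power_series (truncate_coeffs 1 (\<lambda>_. 1))"
  have one: "one \<in> dirichlet_space" unfolding one_def by (rule truncate_in_dirichlet)
  have lam_one: "hankel_coeff lam one = lam"
    unfolding one_def by (simp add: hankel_coeff_truncate fun_eq_iff)
  have one_norm: "(dirichlet_norm one)\<^sup>2 = 1"
    unfolding one_def power_series_in_dirichlet(2)[OF power_series_truncate(1) dirichlet_summable_truncate] dirichlet_sum_truncate
    by (simp add: truncate_coeffs_def)
  have \<mu>: "power_series_on_disk \<mu>" using power_series_on_disk_cnj hc(1)[OF one] by (simp add: \<mu>_def lam_one)
  have G: "dirichlet_summable \<mu>" and GC: "dirichlet_sum \<mu> \<le> C\<^sup>2"
    using hc(2,3)[OF one] by (simp_all add: \<mu>_def lam_one one_norm dirichlet_sum_def)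
  \<comment> \<open>6 = 2 + 4: twice the bound C^2 for the projected part, plus 4 times
    \<open>dirichlet_sum \<mu> \<le> C^2\<close> for the defect.\<close>
  have poly: "(\<integral>\<^sup>+z. ennreal ((cmod (power_series (truncate_coeffs d a) z * power_series (diffs \<mu>) z))\<^sup>2) \<partial>disk_area) \<le>
     ennreal (6 * C\<^sup>2 * (dirichlet_norm (power_series (truncate_coeffs d a)))\<^sup>2)" for d a
  proof -
    let ?P = "power_series (truncate_coeffs d a)"
    have P: "?P \<in> dirichlet_space" by (rule truncate_in_dirichlet)
    have "cnj (hankel_coeff lam ?P (Suc j)) = (\<Sum>k<d. cnj (a k) * \<mu> (Suc j + k))" for j
      unfolding hankel_coeff_truncate by (simp add: \<mu>_def mult.commute)
    hence eq: "cmod (\<Sum>k<d. cnj (a k) * \<mu> (Suc j + k)) = cmod (hankel_coeff lam ?P (Suc j))" for j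
      by (metis complex_mod_cnj)
    have "(\<Sum>j. ennreal (real (j + 1) * (cmod (\<Sum>k<d. cnj (a k) * \<mu> (Suc j + k)))\<^sup>2)) = ennreal (dirichlet_sum (hankel_coeff lam ?P))"
      unfolding eq dirichlet_sum_def using hc(2)[OF P] by (intro suminf_ennreal2) auto
    also have "\<dots> \<le> ennreal (C\<^sup>2 * (dirichlet_norm ?P)\<^sup>2)" by (intro ennreal_leI hc P)
    finally have 1: "2 * (\<Sum>j. ennreal (real (j + 1) * (cmod (\<Sum>k<d. cnj (a k) * \<mu> (Suc j + k)))\<^sup>2)) \<le> 2 * ennreal (C\<^sup>2 * (dirichlet_norm ?P)\<^sup>2)"
      by (intro mult_left_mono) auto
    have "(\<Sum>k<d. real k * (cmod (a k))\<^sup>2) \<le> (dirichlet_norm ?P)\<^sup>2"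
      using dirichlet_norm_sq_bounds(1)[OF P]
      by (simp add: dirichlet_sum_truncate taylor_coeff_power_series power_series_truncate(1))
    hence 2: "4 * dirichlet_sum \<mu> * (\<Sum>k<d. real k * (cmod (a k))\<^sup>2) \<le> 4 * C\<^sup>2 * (dirichlet_norm ?P)\<^sup>2"
      using GC dirichlet_sum_nonneg[OF G] by (intro mult_mono) (auto intro!: sum_nonneg)
    have "(\<integral>\<^sup>+z. ennreal ((cmod (?P z * power_series (diffs \<mu>) z))\<^sup>2) \<partial>disk_area) \<le>
      2 * ennreal (C\<^sup>2 * (dirichlet_norm ?P)\<^sup>2) + ennreal (4 * C\<^sup>2 * (dirichlet_norm ?P)\<^sup>2)"
      by (rule order.trans[OF multiplication_le_small_hankel[OF \<mu> G, where d = d and a = a,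
              folded power_series_truncate(2)] add_mono[OF 1 ennreal_leI[OF 2]]])
    also have "\<dots> = ennreal (2 * (C\<^sup>2 * (dirichlet_norm ?P)\<^sup>2) + 4 * C\<^sup>2 * (dirichlet_norm ?P)\<^sup>2)"
      by (subst ennreal_plus) (auto simp: ennreal_mult)
    finally show ?thesis by (simp add: mult.assoc)
  qed
  \<comment> \<open>Pointwise convergence of the Taylor sections is enough: an upper bound needs
    only lower semicontinuity of the integral.\<close>
  have fatou: "(\<integral>\<^sup>+z. ennreal ((cmod (f z))\<^sup>2) \<partial>symbol_measure \<mu>) \<le> ennreal (6 * C\<^sup>2 * (dirichlet_norm f)\<^sup>2)"
    if f: "f \<in> dirichlet_space" for f
  proof -
    define P where "P = (\<lambda>d. power_series (truncate_coeffs d (taylor_coeff f)))"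
    have hol: "f holomorphic_on unit_disk" using f by (simp add: dirichlet_space_def)
    have [measurable]: "P d \<in> borel_measurable disk_area" "power_series (diffs \<mu>) \<in> borel_measurable disk_area" for d
      unfolding P_def by (intro measurable_power_series power_series_truncate power_series_on_disk_diffs \<mu>)+
    have lim: "(\<lambda>d. P d z) \<longlonglongrightarrow> f z" if "cmod z < 1" for z
      using holomorphic_taylor_sums[OF hol that] by (simp add: P_def power_series_truncate(2) sums_def)
    have "(\<integral>\<^sup>+z. ennreal ((cmod (f z))\<^sup>2) \<partial>symbol_measure \<mu>) =
      (\<integral>\<^sup>+z. liminf (\<lambda>d. ennreal ((cmod (P d z * power_series (diffs \<mu>) z))\<^sup>2)) \<partial>disk_area)"
      unfolding nn_integral_symbol_measure[OF \<mu> dirichlet_measurable[OF f]]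
    proof (intro nn_integral_cong lim_imp_Liminf[symmetric])
      fix z assume "z \<in> space disk_area"
      thus "(\<lambda>d. ennreal ((cmod (P d z * power_series (diffs \<mu>) z))\<^sup>2)) \<longlonglongrightarrow> ennreal ((cmod (f z * power_series (diffs \<mu>) z))\<^sup>2)"
        by (intro tendsto_intros lim) auto
    qed simp
    also have "\<dots> \<le> liminf (\<lambda>d. \<integral>\<^sup>+z. ennreal ((cmod (P d z * power_series (diffs \<mu>) z))\<^sup>2) \<partial>disk_area)"
      by (intro nn_integral_liminf) measurable
    also have "\<dots> \<le> liminf (\<lambda>d. ennreal (6 * C\<^sup>2 * (dirichlet_norm f)\<^sup>2))"
    proof (intro Liminf_mono always_eventually allI)
      fix d
      have "6 * C\<^sup>2 * (dirichlet_norm (P d))\<^sup>2 \<le> 6 * C\<^sup>2 * (dirichlet_norm f)\<^sup>2"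
        unfolding P_def by (intro mult_left_mono power_mono dirichlet_norm_truncate_le f) auto
      thus "(\<integral>\<^sup>+z. ennreal ((cmod (P d z * power_series (diffs \<mu>) z))\<^sup>2) \<partial>disk_area) \<le> ennreal (6 * C\<^sup>2 * (dirichlet_norm f)\<^sup>2)"
        unfolding P_def by (intro order.trans[OF poly] ennreal_leI)
    qed
    also have "\<dots> = ennreal (6 * C\<^sup>2 * (dirichlet_norm f)\<^sup>2)" by (simp add: Liminf_const)
    finally show ?thesis .
  qed
  show "power_series_on_disk (\<lambda>n. cnj (lam n))" using \<mu> by (simp add: \<mu>_def)
  have "dirichlet_carleson (symbol_measure \<mu>)" unfolding dirichlet_carleson_def
  \<comment> \<open>Since 6 \<le> 9, the witness \<open>3 * C\<close> avoids a square root of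
    6.\<close>
  proof (intro conjI exI[of _ "3 * C"] ballI)
    show "sets (symbol_measure \<mu>) = sets (restrict_space borel unit_disk)" by simp
    \<comment> \<open>The total mass is the integral of |1|^2, and the constant 1 lies in the
      Dirichlet space.\<close>
    have "emeasure (symbol_measure \<mu>) (space (symbol_measure \<mu>)) = (\<integral>\<^sup>+z. ennreal ((cmod (1 :: complex))\<^sup>2) \<partial>symbol_measure \<mu>)"
      by simp
    also have "\<dots> = (\<integral>\<^sup>+z. ennreal ((cmod (one z))\<^sup>2) \<partial>symbol_measure \<mu>)"
      by (simp add: one_def power_series_truncate(2))
    also have "\<dots> < \<infinity>" by (rule le_less_trans[OF fatou[OF one]]) simp
    finally show "finite_measure (symbol_measure \<mu>)" by (intro finite_measureI) simp
    show "3 * C > 0" using C by simp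
    fix f assume f: "f \<in> dirichlet_space"
    have m: "f \<in> borel_measurable (symbol_measure \<mu>)"
      using dirichlet_measurable[OF f] by simp
    note * = nn_integral_norm_sq_finiteD[OF m fatou[OF f]]
    show "integrable (symbol_measure \<mu>) (\<lambda>z. (cmod (f z))\<^sup>2)" by (rule *) simp
    have "(LINT z|symbol_measure \<mu>. (cmod (f z))\<^sup>2) \<le> 6 * C\<^sup>2 * (dirichlet_norm f)\<^sup>2" by (rule *) simp
    also have "\<dots> \<le> (3 * C * dirichlet_norm f)\<^sup>2" by (simp add: power_mult_distrib mult_right_mono)
    finally show "sqrt (LINT z|symbol_measure \<mu>. (cmod (f z))\<^sup>2) \<le> 3 * C * dirichlet_norm f"
      using C by (intro real_le_lsqrt) auto
  qed
  thus "dirichlet_carleson (symbol_measure (\<lambda>n. cnj (lam n)))" by (simp add: \<mu>_def)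
qed

text \<open>Finiteness of the measure puts b' in the Bergman space, so \<open>lam\<close> is in
  particular square summable and the inner series converge. The Carleson inequality bounds the
  derivative of H f through \<open>small_hankel_le_multiplication\<close>; the value at 0 is bounded
  by Cauchy-Schwarz.\<close>

lemma carleson_imp_bounded:
  assumes "power_series_on_disk (\<lambda>n. cnj (lam n))" "dirichlet_carleson (symbol_measure (\<lambda>n. cnj (lam n)))"
  shows "hankel_bounded_on_dirichlet lam"
proof -
  define \<mu> where "\<mu> = (\<lambda>n. cnj (lam n))"
  note \<mu> = assms(1)[folded \<mu>_def]
  obtain C where fin: "finite_measure (symbol_measure \<mu>)" and C: "C > 0"
    and int: "\<And>f. f \<in> dirichlet_space \<Longrightarrow> integrable (symbol_measure \<mu>) (\<lambda>z. (cmod (f z))\<^sup>2)"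
    and le: "\<And>f. f \<in> dirichlet_space \<Longrightarrow> sqrt (LINT z|symbol_measure \<mu>. (cmod (f z))\<^sup>2) \<le> C * dirichlet_norm f"
    using assms(2)[folded \<mu>_def] unfolding dirichlet_carleson_def by metis
  have "(\<Sum>n. ennreal (real (n + 1) * (cmod (\<mu> (Suc n)))\<^sup>2)) = (\<integral>\<^sup>+z. ennreal ((cmod (power_series (diffs \<mu>) z))\<^sup>2) \<partial>disk_area)"
    unfolding nn_integral_cmod_sq_power_series[OF power_series_on_disk_diffs[OF \<mu>]] cmod_diffs_sq ..
  also have "\<dots> = emeasure (symbol_measure \<mu>) (space (symbol_measure \<mu>))"
    using nn_integral_symbol_measure[OF \<mu>, of "\<lambda>_. 1"] by simp
  finally have "(\<Sum>n. ennreal (real (n + 1) * (cmod (\<mu> (Suc n)))\<^sup>2)) \<noteq> top"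
    using finite_measure.emeasure_finite[OF fin] by simp
  hence G: "dirichlet_summable \<mu>" by (intro summable_suminf_not_top) auto
  hence Gl: "dirichlet_summable lam" by (simp add: \<mu>_def)
  have sq: "summable (\<lambda>n. (cmod (c n))\<^sup>2)" if "dirichlet_summable c" for c :: "nat \<Rightarrow> complex"
  proof -
    have "summable (\<lambda>n. (cmod (c (Suc n)))\<^sup>2)"
      by (rule summable_comparison_test[OF _ that]) (auto simp: algebra_simps)
    thus ?thesis by (simp only: summable_Suc_iff[of "\<lambda>n. (cmod (c n))\<^sup>2"])
  qed
  have sq_le: "(\<Sum>n. (cmod (taylor_coeff f n))\<^sup>2) \<le> (dirichlet_norm f)\<^sup>2" if f: "f \<in> dirichlet_space" for f
  proof -
    have s: "dirichlet_summable (taylor_coeff f)" using f by (simp add: dirichlet_space_iff)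
    have "(\<Sum>n. (cmod (taylor_coeff f n))\<^sup>2) = (cmod (taylor_coeff f 0))\<^sup>2 + (\<Sum>n. (cmod (taylor_coeff f (Suc n)))\<^sup>2)"
      using suminf_split_head[OF sq[OF s]] by simp
    also have "(\<Sum>n. (cmod (taylor_coeff f (Suc n)))\<^sup>2) \<le> dirichlet_sum (taylor_coeff f)"
      unfolding dirichlet_sum_def using s sq[OF s]
      by (intro suminf_le) (auto simp: algebra_simps summable_Suc_iff[of "\<lambda>n. (cmod (taylor_coeff f n))\<^sup>2"])
    finally show ?thesis by (simp add: dirichlet_norm_sq[OF f])
  qed
  define L where "L = (\<Sum>n. (cmod (lam n))\<^sup>2)"
  have L0: "L \<ge> 0" unfolding L_def using sq[OF Gl] by (intro suminf_nonneg) auto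
  have sh: "summable (\<lambda>k. lam (n + k) * taylor_coeff f k)" if f: "f \<in> dirichlet_space" for f n
  proof (rule summable_comparison_test[OF _ summable_add])
    show "summable (\<lambda>k. (cmod (lam (k + n)))\<^sup>2)" using sq[OF Gl] by (subst summable_iff_shift[of "\<lambda>k. (cmod (lam k))\<^sup>2"])
    show "summable (\<lambda>k. (cmod (taylor_coeff f k))\<^sup>2)" using f by (intro sq) (simp add: dirichlet_space_iff)
    have "norm (x * y) \<le> (norm x)\<^sup>2 + (norm y)\<^sup>2" for x y :: complex
    proof -
      have "2 * (norm x * norm y) \<le> (norm x)\<^sup>2 + (norm y)\<^sup>2" using sum_squares_bound[of "norm x" "norm y"] by simp
      moreover have "norm x * norm y \<ge> 0" by simp
      ultimately have "norm x * norm y \<le> (norm x)\<^sup>2 + (norm y)\<^sup>2" by linarith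
      thus ?thesis by (simp add: norm_mult)
    qed
    thus "\<exists>N. \<forall>k\<ge>N. norm (lam (n + k) * taylor_coeff f k) \<le> (cmod (lam (k + n)))\<^sup>2 + (cmod (taylor_coeff f k))\<^sup>2"
      by (simp only: add.commute[of n]) blast
  qed
  \<comment> \<open>The bound is uniform in n because tails of the square sum of \<open>lam\<close>
    are at most \<open>L\<close>. A geometric majorant then gives convergence on the disk, and n = 0
    bounds the value at the origin.\<close>
  have hc_le: "(cmod (hankel_coeff lam f n))\<^sup>2 \<le> L * (dirichlet_norm f)\<^sup>2" if f: "f \<in> dirichlet_space" for f n
  proof -
    have sf: "summable (\<lambda>k. (cmod (taylor_coeff f k))\<^sup>2)" using f by (intro sq) (simp add: dirichlet_space_iff)
    have sl: "summable (\<lambda>k. (cmod (lam (n + k)))\<^sup>2)"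
      using sq[OF Gl] by (simp only: add.commute[of n] summable_iff_shift[of "\<lambda>k. (cmod (lam k))\<^sup>2"])
    have "ennreal ((cmod (hankel_coeff lam f n))\<^sup>2) \<le>
      (\<Sum>k. ennreal ((cmod (lam (n + k)))\<^sup>2 / 1)) * (\<Sum>k. ennreal (1 * (cmod (taylor_coeff f k))\<^sup>2))"
      unfolding hankel_coeff_def by (rule ennreal_Cauchy_Schwarz_sums[OF summable_sums[OF sh[OF f]]]) simp
    also have "\<dots> = ennreal (\<Sum>k. (cmod (lam (n + k)))\<^sup>2) * ennreal (\<Sum>k. (cmod (taylor_coeff f k))\<^sup>2)"
      using sf sl by (simp add: suminf_ennreal2)
    also have "\<dots> \<le> ennreal L * ennreal ((dirichlet_norm f)\<^sup>2)"
    proof (intro mult_mono ennreal_leI sq_le f)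
      have "(\<Sum>k. (cmod (lam (k + n)))\<^sup>2) + (\<Sum>k<n. (cmod (lam k))\<^sup>2) = L"
        unfolding L_def by (rule suminf_split_initial_segment[OF sq[OF Gl], symmetric])
      thus "(\<Sum>k. (cmod (lam (n + k)))\<^sup>2) \<le> L" using sum_nonneg[of "{..<n}" "\<lambda>k. (cmod (lam k))\<^sup>2"]
        by (simp only: add.commute[of n]) simp
    qed auto
    also have "\<dots> = ennreal (L * (dirichlet_norm f)\<^sup>2)" using L0 by (simp add: ennreal_mult)
    finally show ?thesis using L0 by (simp add: ennreal_le_iff)
  qed
  have disk: "power_series_on_disk (hankel_coeff lam f)" if f: "f \<in> dirichlet_space" for f
    unfolding power_series_on_disk_def
  proof
    fix z assume z: "z \<in> unit_disk"
    let ?K = "sqrt (L * (dirichlet_norm f)\<^sup>2)"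
    show "summable (\<lambda>n. hankel_coeff lam f n * z ^ n)"
    proof (rule summable_comparison_test)
      show "summable (\<lambda>n. ?K * cmod z ^ n)" using z by (intro summable_mult summable_geometric) simp
      have "cmod (hankel_coeff lam f n) \<le> ?K" for n using hc_le[OF f, of n] by (rule real_le_rsqrt)
      thus "\<exists>N. \<forall>n\<ge>N. norm (hankel_coeff lam f n * z ^ n) \<le> ?K * cmod z ^ n"
        by (auto simp: norm_mult norm_power intro!: mult_right_mono)
    qed
  qed
  \<comment> \<open>With \<open>J\<close> fixed, \<open>d\<close> tends to infinity inside a finite
    sum; \<open>J\<close> is released only afterwards, by boundedness of the partial sums.\<close>
  have partial: "(\<Sum>j<J. real (j + 1) * (cmod (hankel_coeff lam f (Suc j)))\<^sup>2) \<le> C\<^sup>2 * (dirichlet_norm f)\<^sup>2"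
    if f: "f \<in> dirichlet_space" for f J
  proof (rule tendsto_upperbound)
    let ?a = "taylor_coeff f"
    have "(\<lambda>d. \<Sum>k<d. lam (Suc j + k) * ?a k) \<longlonglongrightarrow> hankel_coeff lam f (Suc j)" for j
      unfolding hankel_coeff_def by (rule summable_LIMSEQ[OF sh[OF f]])
    thus "(\<lambda>d. \<Sum>j<J. real (j + 1) * (cmod (\<Sum>k<d. lam (Suc j + k) * ?a k))\<^sup>2) \<longlonglongrightarrow>
      (\<Sum>j<J. real (j + 1) * (cmod (hankel_coeff lam f (Suc j)))\<^sup>2)"
      by (intro tendsto_intros)
    have "(\<Sum>j<J. real (j + 1) * (cmod (\<Sum>k<d. lam (Suc j + k) * ?a k))\<^sup>2) \<le> C\<^sup>2 * (dirichlet_norm f)\<^sup>2" for d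
    proof -
      let ?P = "power_series (truncate_coeffs d ?a)"
      have P: "?P \<in> dirichlet_space" by (rule truncate_in_dirichlet)
      note smh = small_hankel_le_multiplication[OF \<mu> G, where d = d and a = ?a, folded power_series_truncate(2)]
      have "cnj (\<Sum>k<d. lam (Suc j + k) * ?a k) = (\<Sum>k<d. cnj (?a k) * \<mu> (Suc j + k))" for j
        by (simp add: \<mu>_def mult.commute)
      hence eq: "cmod (\<Sum>k<d. lam (Suc j + k) * ?a k) = cmod (\<Sum>k<d. cnj (?a k) * \<mu> (Suc j + k))" for j
        by (metis complex_mod_cnj)
      have "ennreal (LINT z|symbol_measure \<mu>. (cmod (?P z))\<^sup>2) = ennreal (LINT z|disk_area. (cmod (?P z * power_series (diffs \<mu>) z))\<^sup>2)"
        using nn_integral_symbol_measure[OF \<mu> dirichlet_measurable[OF P]] nn_integral_eq_integral[OF int[OF P]] nn_integral_eq_integral[OF smh(1)]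
        by simp
      hence eq2: "(LINT z|symbol_measure \<mu>. (cmod (?P z))\<^sup>2) = (LINT z|disk_area. (cmod (?P z * power_series (diffs \<mu>) z))\<^sup>2)"
        by (subst (asm) ennreal_inj) auto
      have "(\<Sum>j<J. real (j + 1) * (cmod (\<Sum>k<d. lam (Suc j + k) * ?a k))\<^sup>2) \<le> (LINT z|symbol_measure \<mu>. (cmod (?P z))\<^sup>2)"
        unfolding eq eq2 by (rule smh)
      also have "\<dots> \<le> (C * dirichlet_norm ?P)\<^sup>2" using le[OF P] by (rule sqrt_le_D)
      also have "\<dots> \<le> (C * dirichlet_norm f)\<^sup>2"
        using C by (intro power_mono mult_left_mono dirichlet_norm_truncate_le f) auto
      finally show ?thesis by (simp add: power_mult_distrib)
    qed
    thus "\<forall>\<^sub>F d in sequentially. (\<Sum>j<J. real (j + 1) * (cmod (\<Sum>k<d. lam (Suc j + k) * ?a k))\<^sup>2) \<le> C\<^sup>2 * (dirichlet_norm f)\<^sup>2"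
      by simp
  qed simp
  \<comment> \<open>\<open>L\<close> accounts for the squared value at 0 and \<open>C^2\<close> for
    the Dirichlet integral.\<close>
  have op: "hankel_op lam f \<in> dirichlet_space" "dirichlet_norm (hankel_op lam f) \<le> sqrt (L + C\<^sup>2) * dirichlet_norm f"
    if f: "f \<in> dirichlet_space" for f
  proof -
    have s: "dirichlet_summable (hankel_coeff lam f)"
    proof (rule bounded_imp_summable)
      show "(\<Sum>j\<le>n. real (j + 1) * (cmod (hankel_coeff lam f (Suc j)))\<^sup>2) \<le> C\<^sup>2 * (dirichlet_norm f)\<^sup>2" for n
        using partial[OF f, of "Suc n"] by (simp only: lessThan_Suc_atMost)
    qed simp
    show "hankel_op lam f \<in> dirichlet_space"
      unfolding hankel_op_def by (rule power_series_in_dirichlet(1)[OF disk[OF f] s])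
    have "dirichlet_sum (hankel_coeff lam f) \<le> C\<^sup>2 * (dirichlet_norm f)\<^sup>2"
      unfolding dirichlet_sum_def using partial[OF f] s by (intro suminf_le_const) auto
    hence "(dirichlet_norm (hankel_op lam f))\<^sup>2 \<le> (L + C\<^sup>2) * (dirichlet_norm f)\<^sup>2"
      unfolding hankel_op_def power_series_in_dirichlet(2)[OF disk[OF f] s]
      using hc_le[OF f, of 0] by (simp add: algebra_simps)
    hence "dirichlet_norm (hankel_op lam f) \<le> sqrt ((L + C\<^sup>2) * (dirichlet_norm f)\<^sup>2)" by (rule real_le_rsqrt)
    thus "dirichlet_norm (hankel_op lam f) \<le> sqrt (L + C\<^sup>2) * dirichlet_norm f" by (simp add: real_sqrt_mult)
  qed
  have pos: "sqrt (L + C\<^sup>2) > 0" using add_nonneg_pos[OF L0, of "C\<^sup>2"] C by simp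
  show ?thesis unfolding hankel_bounded_on_dirichlet_def hankel_well_defined_def
    by (intro conjI ballI allI exI[of _ "sqrt (L + C\<^sup>2)"] sh disk op pos)
qed

theorem theorem1p1:
  fixes lam :: "nat \<Rightarrow> complex"
  shows "hankel_bounded_on_dirichlet lam \<longleftrightarrow>
    power_series_on_disk (\<lambda>n. cnj (lam n)) \<and>
    dirichlet_carleson
      (density disk_area (\<lambda>z. ennreal ((cmod (deriv (conj_symbol lam) z))\<^sup>2)))"
  unfolding conj_symbol_def using bounded_imp_carleson carleson_imp_bounded by blast

end
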